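(* Let $u\in\mathcal{C}^2(\mathbb{D})$ be a $T_2$-harmonic function satisfying $u(0)=|J_u(0)|-1=0$ and $\sup_{z\in\mathbb{D}}|u(z)|\leq M$, where $M>0$ and $J_u$ is the Jacobian of $u$. Then $u$ is univalent on $\mathbb{D}_{r_0}$, where $r_0\in(0,1)$ satisfies the equation $$\frac{\pi}{4M}-\frac{4}{\pi}\,\frac{M r_0}{(1-r_0)^3}\left(-r_0^3+3r_0^2-3r_0+3\right)=0.$$ Moreover, $u(\mathbb{D}_{r_0})$ contains a univalent disk $\mathbb{D}_{R_0}$ with $$R_0\geq \frac{4M r_0^2}{\pi(1-r_0)^3}\left[-\frac45 r_0^3+\frac94 r_0^2-2r_0+\frac32\right].$$
   Context: $\mathbb{D}=\{z\in\mathbb{C}:|z|<1\}$ and $\mathbb{D}_r=\{z\in\mathbb{C}:|z|<r\}$. For $\alpha\in\mathbb{R}$, a complex-valued function $u\in\mathcal{C}^2(\mathbb{D})$ is called $T_\alpha$-harmonic if $T_\alpha(u)=0$ in $\mathbb{D}$, where $$T_\alpha=-\frac{\alpha^2}{4}(1-|z|^2)^{-(\alpha+1)}+\frac12 L_\alpha+\frac12\overline{L_\alpha},\qquad L_\alpha=\frac{\partial}{\partial\overline z}(1-|z|^2)^{-\alpha}\frac{\partial}{\partial z},\qquad \overline{L_\alpha}=\frac{\partial}{\partial z}(1-|z|^2)^{-\alpha}\frac{\partial}{\partial \overline z},$$ with $\frac{\partial}{\partial z}=\frac12(\partial_x-i\partial_y)$ and $\frac{\partial}{\partial\overline z}=\frac12(\partial_x+i\partial_y)$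 for $z=x+iy$; the first term of $T_\alpha$ is multiplication by the given function. $T_2$-harmonic means the case $\alpha=2$. The Jacobian is $J_u=|u_z|^2-|u_{\overline z}|^2$. Univalent means injective; a univalent disk in the image $u(\Omega)$ is a disk contained in $u(\Omega)$ that is the injective image under $u$ of a subdomain of $\Omega$. *)

theory Defs
  imports "HOL-Analysis.Analysis"
begin

definition partial_x :: "(complex \<Rightarrow> complex) \<Rightarrow> complex \<Rightarrow> complex" where
  "partial_x f z = vector_derivative (\<lambda>t::real. f (z + of_real t)) (at 0)"

definition partial_y :: "(complex \<Rightarrow> complex) \<Rightarrow> complex \<Rightarrow> complex" where
  "partial_y f z = vector_derivative (\<lambda>t::real. f (z + \<i> * of_real t)) (at 0)"

(* Real differentiability of class C^k on an open set; "differentiable" is real Frechet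
   differentiability, not complex differentiability. *)
fun Ck_on :: "nat \<Rightarrow> (complex \<Rightarrow> complex) \<Rightarrow> complex set \<Rightarrow> bool" where
  "Ck_on 0 f S \<longleftrightarrow> continuous_on S f"
| "Ck_on (Suc k) f S \<longleftrightarrow>
     (\<forall>z\<in>S. f differentiable (at z)) \<and> Ck_on k (partial_x f) S \<and> Ck_on k (partial_y f) S"

definition wirtinger :: "(complex \<Rightarrow> complex) \<Rightarrow> complex \<Rightarrow> complex" where
  "wirtinger f z = (partial_x f z - \<i> * partial_y f z) / 2"

definition wirtinger_bar :: "(complex \<Rightarrow> complex) \<Rightarrow> complex \<Rightarrow> complex" where
  "wirtinger_bar f z = (partial_x f z + \<i> * partial_y f z) / 2"

definition Jac :: "(complex \<Rightarrow> complex) \<Rightarrow> complex \<Rightarrow> real" where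
  "Jac f z = (cmod (wirtinger f z))\<^sup>2 - (cmod (wirtinger_bar f z))\<^sup>2"

definition L_op :: "real \<Rightarrow> (complex \<Rightarrow> complex) \<Rightarrow> complex \<Rightarrow> complex" where
  "L_op \<alpha> u = wirtinger_bar (\<lambda>w. of_real ((1 - (cmod w)\<^sup>2) powr (-\<alpha>)) * wirtinger u w)"

definition L_bar_op :: "real \<Rightarrow> (complex \<Rightarrow> complex) \<Rightarrow> complex \<Rightarrow> complex" where
  "L_bar_op \<alpha> u = wirtinger (\<lambda>w. of_real ((1 - (cmod w)\<^sup>2) powr (-\<alpha>)) * wirtinger_bar u w)"

definition T_op :: "real \<Rightarrow> (complex \<Rightarrow> complex) \<Rightarrow> complex \<Rightarrow> complex" where
  "T_op \<alpha> u z =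
     - of_real (\<alpha>\<^sup>2 / 4 * (1 - (cmod z)\<^sup>2) powr (- (\<alpha> + 1))) * u z
     + 1/2 * L_op \<alpha> u z + 1/2 * L_bar_op \<alpha> u z"

definition T_harmonic :: "real \<Rightarrow> (complex \<Rightarrow> complex) \<Rightarrow> bool" where
  "T_harmonic \<alpha> u \<longleftrightarrow> Ck_on 2 u (ball 0 1) \<and> (\<forall>z\<in>ball 0 1. T_op \<alpha> u z = 0)"

definition univalent_disk ::
  "(complex \<Rightarrow> complex) \<Rightarrow> complex set \<Rightarrow> complex \<Rightarrow> real \<Rightarrow> bool" where
  "univalent_disk u \<Omega> c R \<longleftrightarrow>
     0 < R \<and> ball c R \<subseteq> u ` \<Omega> \<and>
     (\<exists>U\<subseteq>\<Omega>. open U \<and> connected U \<and> U \<noteq> {} \<and> inj_on u U \<and> u ` U = ball c R)"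

end

theory Submission
  imports Defs
begin

text \<open>For \<open>\<alpha> = 2\<close> the equation \<open>T_op 2 u = 0\<close> says
\<open>(1 - |z|\<^sup>2)/4 * \<Delta>u + Eu - u = 0\<close>, where \<open>E = x \<partial>\<^sub>x + y \<partial>\<^sub>y\<close> is the
Euler operator (\<open>T2_harmonic_pde\<close>). This equation is invariant under rotations, so it
separates: the \<open>k\<close>-th Fourier coefficient of \<open>u\<close> on the circle of radius \<open>r\<close> solves a second
order ordinary differential equation in \<open>r\<close>. The polynomial
\<open>r^n - (n-1)/(n+1) * r^(n+2)\<close>, \<open>n = |k|\<close>, is a solution that is regular at the origin, and the
Wronskian shows that every regular solution is a multiple of it
(\<open>fourier_coeff_eq_radial\<close>). A continuous function on a circle is determined by its Fourier
coefficients (\<open>null_fourier_imp_zero\<close>), hence \<open>u\<close> is the sum of the modes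
\<open>(a\<^sub>n z^n + b\<^sub>n cnj z^n) (1 - (n-1)/(n+1) * |z|\<^sup>2)\<close> (\<open>T2_harmonic_expansion\<close>).

The bound \<open>|u| \<le> M\<close> controls the modes. A suitable combination of \<open>cis (n t)\<close> and
\<open>cis (- n t)\<close> with unimodular coefficients is \<open>2 cos (n t + c)\<close> up to a unimodular factor, and
the mean value of its modulus is \<open>4/\<pi>\<close>. Letting \<open>r\<close> tend to \<open>1\<close>, where the radial factor
tends to \<open>2/(n+1)\<close>, one gets \<open>|a\<^sub>n| + |b\<^sub>n| \<le> 2 (n+1) M / \<pi>\<close>.

Write \<open>u = L + R\<close> with the real linear part \<open>L z = a z + b cnj z\<close>. Because
\<open>|J\<^sub>u(0)| = ||a|\<^sup>2 - |b|\<^sup>2| = 1\<close> and \<open>|a| + |b| \<le> 4M/\<pi>\<close>, the map \<open>L\<close> expands distances by a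
factor of at least \<open>\<pi>/(4M)\<close>. Adding up the Lipschitz constants of the single modes of degree
at least \<open>2\<close> on the disk of radius \<open>s\<close> gives exactly the second term of the equation for
\<open>r\<^sub>0\<close> (\<open>T2_harmonic_decomposition\<close>). That term increases strictly with \<open>s\<close>, so
\<open>R\<close> has Lipschitz constant smaller than \<open>\<pi>/(4M)\<close> on every disk of radius \<open>s < r\<^sub>0\<close> and \<open>u\<close> is
injective on the disk of radius \<open>r\<^sub>0\<close>. For the image, \<open>|u| \<ge> \<pi>/(4M) * s - sup |R|\<close> holds on the
circle of radius \<open>s\<close>; with \<open>s\<close> close to \<open>r\<^sub>0\<close> this exceeds every number below the stated
radius, and an open image whose boundary stays outside a disk around one of its points contains
that disk (\<open>univalent_disk_of_boundary_bound\<close>).\<close>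

section \<open>The differential equation in Cartesian form\<close>

text \<open>The partial derivatives are vector derivatives along lines. This lemma and the next one
  translate between them and the Frechet derivative, for which the derivative rules can be applied.\<close>

lemma partials_of_has_derivative:
  assumes "(f has_derivative D) (at z)"
  shows "partial_x f z = D 1" "partial_y f z = D \<i>"
proof -
  have "((\<lambda>t::real. z + of_real t) has_vector_derivative 1) (at 0)"
       "((\<lambda>t::real. z + \<i> * of_real t) has_vector_derivative \<i>) (at 0)"
    by (auto intro!: derivative_eq_intros)
  from this[THEN vector_derivative_diff_chain_within, of f D] assms
  have "((\<lambda>t::real. f (z + of_real t)) has_vector_derivative D 1) (at 0)"
       "((\<lambda>t::real. f (z + \<i> * of_real t)) has_vector_derivative D \<i>) (at 0)"
    by (auto simp: o_def intro: has_derivative_at_withinI)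
  then show "partial_x f z = D 1" "partial_y f z = D \<i>"
    by (auto simp: partial_x_def partial_y_def intro: vector_derivative_at)
qed

lemma has_derivative_partials:
  assumes "f differentiable at z"
  shows "(f has_derivative (\<lambda>h. of_real (Re h) * partial_x f z + of_real (Im h) * partial_y f z)) (at z)"
proof -
  obtain D where D: "(f has_derivative D) (at z)"
    using assms unfolding differentiable_def by blast
  interpret bounded_linear D using D by (rule has_derivative_bounded_linear)
  have "D h = of_real (Re h) * partial_x f z + of_real (Im h) * partial_y f z" for h
  proof -
    have "h = Re h *\<^sub>R 1 + Im h *\<^sub>R \<i>"
      by (simp add: complex_eq_iff)
    then have "D h = D (Re h *\<^sub>R 1 + Im h *\<^sub>R \<i>)"
      by simp
    also have "\<dots> = Re h *\<^sub>R D 1 + Im h *\<^sub>R D \<i>"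
      by (simp only: add scaleR)
    finally show ?thesis
      by (simp add: partials_of_has_derivative[OF D] scaleR_conv_of_real)
  qed
  then have "D = (\<lambda>h. of_real (Re h) * partial_x f z + of_real (Im h) * partial_y f z)" ..
  with D show ?thesis by simp
qed

lemma has_vector_derivative_along_curve:
  assumes "f differentiable at (g t)" "(g has_vector_derivative d) (at t)"
  shows "((\<lambda>s. f (g s)) has_vector_derivative
           (of_real (Re d) * partial_x f (g t) + of_real (Im d) * partial_y f (g t))) (at t)"
  using vector_derivative_diff_chain_within[OF assms(2)
      has_derivative_at_withinI[OF has_derivative_partials[OF assms(1)]]]
  by (simp add: o_def)

definition euler :: "(complex \<Rightarrow> complex) \<Rightarrow> complex \<Rightarrow> complex" where
  "euler f z = of_real (Re z) * partial_x f z + of_real (Im z) * partial_y f z"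

definition angular :: "(complex \<Rightarrow> complex) \<Rightarrow> complex \<Rightarrow> complex" where
  "angular f z = of_real (Re z) * partial_y f z - of_real (Im z) * partial_x f z"

text \<open>In polar coordinates \<open>euler\<close> is \<open>r \<partial>\<^sub>r\<close> and \<open>angular\<close> is \<open>\<partial>\<^sub>t\<close>, so the last equation is the
  polar form of \<open>r\<^sup>2 \<Delta>\<close>. Working with these two operators instead of \<open>\<partial>\<^sub>r\<close> keeps every function
  defined and continuous at the origin. Each mixed second derivative of \<open>u\<close> enters the two
  summands with opposite signs and cancels.\<close>

lemma Ck_on_1_euler_angular:
  assumes "Ck_on 2 u S" "open S"
  shows "Ck_on 1 (euler u) S" "Ck_on 1 (angular u) S"
    and "z \<in> S \<Longrightarrow> euler (euler u) z + angular (angular u) z =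
       of_real ((cmod z)\<^sup>2) * (partial_x (partial_x u) z + partial_y (partial_y u) z)"
proof -
  have u: "continuous_on S (partial_x (partial_x u))" "continuous_on S (partial_y (partial_x u))"
    "continuous_on S (partial_x (partial_y u))" "continuous_on S (partial_y (partial_y u))"
    "\<And>z. z \<in> S \<Longrightarrow> u differentiable at z"
    "\<And>z. z \<in> S \<Longrightarrow> partial_x u differentiable at z"
    "\<And>z. z \<in> S \<Longrightarrow> partial_y u differentiable at z"
    using assms by (auto simp: numeral_2_eq_2)
  have c: "continuous_on S (partial_x u)" "continuous_on S (partial_y u)"
    using u by (meson continuous_at_imp_continuous_on differentiable_imp_continuous_within)+
  have E: "(euler u has_derivative (\<lambda>h. of_real (Re h) * partial_x u z + of_real (Im h) * partial_y u z
      + of_real (Re z) * (of_real (Re h) * partial_x (partial_x u) z + of_real (Im h) * partial_y (partial_x u) z)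
      + of_real (Im z) * (of_real (Re h) * partial_x (partial_y u) z + of_real (Im h) * partial_y (partial_y u) z)))
     (at z)"
    if "z \<in> S" for z
    unfolding euler_def
    by (rule derivative_eq_intros has_derivative_partials u that refl)+ (simp add: algebra_simps)
  have A: "(angular u has_derivative (\<lambda>h. of_real (Re h) * partial_y u z - of_real (Im h) * partial_x u z
      + of_real (Re z) * (of_real (Re h) * partial_x (partial_y u) z + of_real (Im h) * partial_y (partial_y u) z)
      - of_real (Im z) * (of_real (Re h) * partial_x (partial_x u) z + of_real (Im h) * partial_y (partial_x u) z)))
     (at z)"
    if "z \<in> S" for z
    unfolding angular_def
    by (rule derivative_eq_intros has_derivative_partials u that refl)+ (simp add: algebra_simps)
  note pE = partials_of_has_derivative[OF E, simplified]
  note pA = partials_of_has_derivative[OF A, simplified]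
  have "continuous_on S (partial_x (euler u))" "continuous_on S (partial_y (euler u))"
       "continuous_on S (partial_x (angular u))" "continuous_on S (partial_y (angular u))"
    by (simp_all add: pE pA u c continuous_intros cong: continuous_on_cong)
  with E A show "Ck_on 1 (euler u) S" "Ck_on 1 (angular u) S"
    by (auto simp: differentiable_def)
  show "euler (euler u) z + angular (angular u) z =
       of_real ((cmod z)\<^sup>2) * (partial_x (partial_x u) z + partial_y (partial_y u) z)" if "z \<in> S"
    unfolding euler_def[of "euler u"] angular_def[of "angular u"] pE[OF that] pA[OF that]
    unfolding cmod_power2 by (simp add: algebra_simps power2_eq_square)
qed

lemma has_derivative_weight:
  assumes "cmod z < 1"
  shows "((\<lambda>w. complex_of_real ((1 - (cmod w)\<^sup>2) powr (-2))) has_derivative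
     (\<lambda>h. of_real (4 * (Re z * Re h + Im z * Im h) * (1 - (cmod z)\<^sup>2) powr (-3)))) (at z)"
proof -
  have p: "1 - (cmod z)\<^sup>2 > 0" using assms by (simp add: power_less_one_iff abs_square_less_1)
  have "((\<lambda>w. 1 - (cmod w)\<^sup>2) has_derivative (\<lambda>h. - (2 * (Re z * Re h + Im z * Im h)))) (at z)"
    unfolding cmod_power2 by (auto intro!: derivative_eq_intros simp: algebra_simps)
  moreover have "((\<lambda>x. x powr (-2)) has_field_derivative (-2) * (1 - (cmod z)\<^sup>2) powr (-3)) (at (1 - (cmod z)\<^sup>2))"
    using has_real_derivative_powr[OF p, of "-2"] by simp
  ultimately have "((\<lambda>w. (1 - (cmod w)\<^sup>2) powr (-2)) has_derivative
     (\<lambda>h. - (2 * (Re z * Re h + Im z * Im h)) * ((-2) * (1 - (cmod z)\<^sup>2) powr (-3)))) (at z)"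
    by (rule DERIV_compose_FDERIV[rotated])
  then have "((\<lambda>w. complex_of_real ((1 - (cmod w)\<^sup>2) powr (-2))) has_derivative
     (\<lambda>h. of_real (- (2 * (Re z * Re h + Im z * Im h)) * ((-2) * (1 - (cmod z)\<^sup>2) powr (-3))))) (at z)"
    by (rule has_derivative_of_real)
  then show ?thesis by (simp add: algebra_simps)
qed

text \<open>Differentiating the weight \<open>(1 - |z|\<^sup>2)^(-2)\<close> contributes \<open>2 z (1 - |z|\<^sup>2)^(-3)\<close> to
  the coefficient of \<open>\<partial>u\<close>, and its conjugate to that of the conjugate derivative; together
  these terms give the Euler operator. Multiplying by \<open>4 (1 - |z|\<^sup>2)^3\<close> clears all weights.\<close>

lemma T2_harmonic_pde:
  assumes "T_harmonic 2 u" "cmod z < 1"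
  shows "of_real (1 - (cmod z)\<^sup>2) * (partial_x (partial_x u) z + partial_y (partial_y u) z)
           + 4 * euler u z - 4 * u z = 0"
proof -
  have zb: "z \<in> ball 0 1" using assms by simp
  have u: "partial_x u differentiable at z" "partial_y u differentiable at z"
    using assms zb by (auto simp: T_harmonic_def numeral_2_eq_2)
  define \<rho> where "\<rho> = 1 - (cmod z)\<^sup>2"
  have p: "\<rho> > 0" using assms(2) by (simp add: \<rho>_def power_less_one_iff abs_square_less_1)
  define W where "W = complex_of_real (inverse (\<rho> ^ 3))"
  have W: "complex_of_real (\<rho> powr (-3)) = W" "complex_of_real (\<rho> powr (-2)) = of_real \<rho> * W"
    using p by (simp_all add: W_def powr_minus powr_numeral power3_eq_cube power2_eq_square field_simps)
  note D = derivative_eq_intros has_derivative_weight[OF assms(2)] has_derivative_partials[OF u(1)]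
      has_derivative_partials[OF u(2)]
  have 1: "((\<lambda>w. complex_of_real ((1 - (cmod w)\<^sup>2) powr (-2)) * wirtinger u w) has_derivative
     (\<lambda>h. of_real (4 * (Re z * Re h + Im z * Im h)) * W * wirtinger u z
       + of_real \<rho> * W * ((of_real (Re h) * partial_x (partial_x u) z + of_real (Im h) * partial_y (partial_x u) z)
           - \<i> * (of_real (Re h) * partial_x (partial_y u) z + of_real (Im h) * partial_y (partial_y u) z)) / 2)) (at z)"
    unfolding wirtinger_def
    by (rule D refl | simp)+ (simp add: W \<rho>_def[symmetric] fun_eq_iff field_simps)
  have 2: "((\<lambda>w. complex_of_real ((1 - (cmod w)\<^sup>2) powr (-2)) * wirtinger_bar u w) has_derivative
     (\<lambda>h. of_real (4 * (Re z * Re h + Im z * Im h)) * W * wirtinger_bar u z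
       + of_real \<rho> * W * ((of_real (Re h) * partial_x (partial_x u) z + of_real (Im h) * partial_y (partial_x u) z)
           + \<i> * (of_real (Re h) * partial_x (partial_y u) z + of_real (Im h) * partial_y (partial_y u) z)) / 2)) (at z)"
    unfolding wirtinger_bar_def
    by (rule D refl | simp)+ (simp add: W \<rho>_def[symmetric] fun_eq_iff field_simps)
  have "T_op 2 u z = 0" using assms zb by (auto simp: T_harmonic_def)
  then have T: "0 = - (W * u z) + 1/2 * L_op 2 u z + 1/2 * L_bar_op 2 u z"
    by (simp add: T_op_def W \<rho>_def[symmetric])
  have "0 = 4 * (- (W * u z) + 1/2 * L_op 2 u z + 1/2 * L_bar_op 2 u z)"
    using T by simp
  also have "\<dots> = W * (of_real \<rho> * (partial_x (partial_x u) z + partial_y (partial_y u) z)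
           + 4 * euler u z - 4 * u z)"
    unfolding L_op_def L_bar_op_def
    unfolding wirtinger_bar_def[of "\<lambda>w. _ w * _ w"] wirtinger_def[of "\<lambda>w. _ w * _ w"]
      partials_of_has_derivative[OF 1] partials_of_has_derivative[OF 2]
    unfolding wirtinger_bar_def wirtinger_def euler_def
    by (simp add: field_simps)
  finally have "of_real \<rho> * (partial_x (partial_x u) z + partial_y (partial_y u) z)
           + 4 * euler u z - 4 * u z = 0"
    using p by (simp add: W_def)
  then show ?thesis unfolding \<rho>_def .
qed

section \<open>Fourier coefficients over circles\<close>

definition fourier_coeff :: "int \<Rightarrow> (complex \<Rightarrow> complex) \<Rightarrow> real \<Rightarrow> complex" where
  "fourier_coeff k f r = integral {0..2*pi} (\<lambda>t. f (of_real r * cis t) * cis (- (of_int k * t)))"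

lemma continuous_on_polar:
  assumes "continuous_on (ball 0 1) f"
  shows "continuous_on ({-1<..<1} \<times> A) (\<lambda>(r,t). f (of_real r * cis t) * cis (- (of_int k * t)))"
proof -
  have "continuous_on ({-1<..<1} \<times> A) (\<lambda>p. f (of_real (fst p) * cis (snd p)))"
    by (rule continuous_on_compose2[OF assms]) (auto intro!: continuous_intros simp: norm_mult)
  then show ?thesis
    unfolding case_prod_beta by (intro continuous_intros)
qed

lemma continuous_on_circle:
  assumes "continuous_on (ball 0 1) f" "\<bar>r\<bar> < 1"
  shows "continuous_on A (\<lambda>t. f (of_real r * cis t) * cis (- (of_int k * t)))"
proof -
  have "continuous_on A (\<lambda>t. f (of_real r * cis t))"
    by (rule continuous_on_compose2[OF assms(1)]) (use assms(2) in \<open>auto intro!: continuous_intros simp: norm_mult\<close>)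
  then show ?thesis by (intro continuous_intros)
qed

lemma fourier_coeff_has_integral:
  assumes "continuous_on (ball 0 1) f" "\<bar>r\<bar> < 1"
  shows "((\<lambda>t. f (of_real r * cis t) * cis (- (of_int k * t))) has_integral fourier_coeff k f r) {0..2*pi}"
  unfolding fourier_coeff_def
  by (intro integrable_integral integrable_continuous_real continuous_on_circle assms)

lemma continuous_on_fourier_coeff:
  assumes "continuous_on (ball 0 1) f"
  shows "continuous_on {-1<..<1} (fourier_coeff k f)"
  unfolding fourier_coeff_def
  using integral_continuous_on_param[OF continuous_on_polar[OF assms, of "cbox 0 (2*pi)"]]
  by simp

lemma Ck_on_1_imp_continuous_on:
  "Ck_on 1 f S \<Longrightarrow> continuous_on S f"
  by (auto intro!: continuous_at_imp_continuous_on dest: differentiable_imp_continuous_within)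

lemma Ck_on_2_imp_1:
  assumes "Ck_on 2 f S" shows "Ck_on 1 f S"
proof -
  have "Ck_on 1 (partial_x f) S" "Ck_on 1 (partial_y f) S" "\<forall>z\<in>S. f differentiable at z"
    using assms by (simp_all add: numeral_2_eq_2)
  from this(3) this(1,2)[THEN Ck_on_1_imp_continuous_on] show ?thesis by simp
qed

lemma has_vector_derivative_cis: "(cis has_vector_derivative \<i> * cis t) (at t)"
  unfolding has_vector_derivative_def by (auto intro!: derivative_eq_intros)

lemma continuous_on_euler_angular:
  assumes "Ck_on 1 f S"
  shows "continuous_on S (euler f)" "continuous_on S (angular f)"
  using assms unfolding euler_def angular_def
  by (auto intro!: continuous_on_add continuous_on_diff continuous_on_mult continuous_on_of_real continuous_on_Re continuous_on_Im)

text \<open>Differentiation under the integral sign, since \<open>f (r cis t)\<close> has \<open>r\<close>-derivative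
  \<open>euler f (r cis t) / r\<close>.\<close>

lemma fourier_coeff_radial_derivative:
  assumes f: "Ck_on 1 f (ball 0 1)" and r: "0 < r" "r < 1"
  shows "(fourier_coeff k f has_vector_derivative fourier_coeff k (euler f) r / of_real r) (at r)"
proof -
  let ?g = "\<lambda>r t. f (of_real r * cis t) * cis (- (of_int k * t))"
  let ?g' = "\<lambda>r t. euler f (of_real r * cis t) * cis (- (of_int k * t)) / of_real r"
  have "((\<lambda>r. integral (cbox 0 (2*pi)) (?g r)) has_vector_derivative integral (cbox 0 (2*pi)) (?g' r))
      (at r within {0<..<1})"
  proof (rule leibniz_rule_vector_derivative)
    fix x t :: real assume x: "x \<in> {0<..<1}"
    have "((\<lambda>x. f (of_real x * cis t)) has_vector_derivative
       (of_real (Re (cis t)) * partial_x f (of_real x * cis t)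
         + of_real (Im (cis t)) * partial_y f (of_real x * cis t))) (at x)"
      by (rule has_vector_derivative_along_curve)
         (use f x in \<open>auto simp: norm_mult intro!: derivative_eq_intros\<close>)
    note has_vector_derivative_mult_left[OF this, of "cis (- (of_int k * t))"]
    moreover have "(of_real (Re (cis t)) * partial_x f (of_real x * cis t)
         + of_real (Im (cis t)) * partial_y f (of_real x * cis t)) * cis (- (of_int k * t)) = ?g' x t"
      by (use x in \<open>simp add: euler_def field_simps\<close>)
    ultimately have "((\<lambda>x. ?g x t) has_vector_derivative ?g' x t) (at x)" by simp
    then show "((\<lambda>x. ?g x t) has_vector_derivative ?g' x t) (at x within {0<..<1})"
      by (rule has_vector_derivative_at_within)
  next
    have "continuous_on ({-1<..<1} \<times> cbox 0 (2*pi)) (\<lambda>(r,t). euler f (of_real r * cis t) * cis (- (of_int k * t)))"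
      by (intro continuous_on_polar continuous_on_euler_angular f)
    then have "continuous_on ({0<..<1} \<times> cbox 0 (2*pi)) (\<lambda>(r,t). euler f (of_real r * cis t) * cis (- (of_int k * t)))"
      by (rule continuous_on_subset) auto
    then show "continuous_on ({0<..<1} \<times> cbox 0 (2*pi)) (\<lambda>(r,t). ?g' r t)"
      unfolding case_prod_beta by (rule continuous_on_divide) (auto intro!: continuous_intros)
  next
    show "?g x integrable_on cbox 0 (2 * pi)" if "x \<in> {0<..<1}" for x
      using fourier_coeff_has_integral[OF Ck_on_1_imp_continuous_on[OF f], of x] that by auto
  qed (use r in auto)
  then show ?thesis
    using r unfolding fourier_coeff_def
    by (subst (asm) at_within_open) auto
qed

text \<open>Integration by parts over a full period: the function
  \<open>t \<mapsto> f (r cis t) cis (- k t)\<close> takes the same value at both ends.\<close>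

lemma fourier_coeff_angular:
  assumes f: "Ck_on 1 f (ball 0 1)" and r: "\<bar>r\<bar> < 1"
  shows "fourier_coeff k (angular f) r = \<i> * of_int k * fourier_coeff k f r"
proof -
  let ?g = "\<lambda>t. f (of_real r * cis t) * cis (- (of_int k * t))"
  let ?h = "\<lambda>t. angular f (of_real r * cis t) * cis (- (of_int k * t))"
  have "((\<lambda>t. ?h t - \<i> * of_int k * ?g t) has_integral ?g (2*pi) - ?g 0) {0..2*pi}"
  proof (rule fundamental_theorem_of_calculus)
    fix t :: real
    have "((\<lambda>t. f (of_real r * cis t)) has_vector_derivative
       (of_real (Re (of_real r * (\<i> * cis t))) * partial_x f (of_real r * cis t)
         + of_real (Im (of_real r * (\<i> * cis t))) * partial_y f (of_real r * cis t))) (at t)"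
      by (rule has_vector_derivative_along_curve)
         (use f r in \<open>auto simp: norm_mult intro!: derivative_eq_intros has_vector_derivative_cis\<close>)
    moreover have "((\<lambda>t. cis (- (of_int k * t))) has_vector_derivative - \<i> * of_int k * cis (- (of_int k * t))) (at t)"
      unfolding has_vector_derivative_def
      by (auto intro!: derivative_eq_intros simp: scaleR_conv_of_real)
    ultimately have "(?g has_vector_derivative
        (f (of_real r * cis t) * (- \<i> * of_int k * cis (- (of_int k * t)))
          + (of_real (Re (of_real r * (\<i> * cis t))) * partial_x f (of_real r * cis t)
         + of_real (Im (of_real r * (\<i> * cis t))) * partial_y f (of_real r * cis t)) * cis (- (of_int k * t)))) (at t)"
      by (rule has_vector_derivative_mult)
    then have "(?g has_vector_derivative (?h t - \<i> * of_int k * ?g t)) (at t)"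
      by (simp add: angular_def algebra_simps)
    then show "(?g has_vector_derivative (?h t - \<i> * of_int k * ?g t)) (at t within {0..2*pi})"
      by (rule has_vector_derivative_at_within)
  qed simp
  moreover have "?g (2*pi) - ?g 0 = 0"
  proof -
    have "cis (- (of_int k * (2*pi))) = 1"
      using cis_multiple_2pi[of "- of_int k"] by (simp add: mult_ac)
    then show ?thesis by simp
  qed
  moreover have "((\<lambda>t. ?h t - \<i> * of_int k * ?g t) has_integral
      fourier_coeff k (angular f) r - \<i> * of_int k * fourier_coeff k f r) {0..2*pi}"
    by (intro has_integral_diff has_integral_mult_right fourier_coeff_has_integral r
        Ck_on_1_imp_continuous_on[OF f] continuous_on_euler_angular[OF f])
  ultimately have "fourier_coeff k (angular f) r - \<i> * of_int k * fourier_coeff k f r = 0"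
    by (auto dest: has_integral_unique)
  then show ?thesis by simp
qed

text \<open>Each Fourier coefficient is an integral over a circle, on which the coefficients of the
  equation are constant, so the equation passes to the Fourier coefficients with the second
  angular derivative replaced by \<open>- k\<^sup>2\<close>.\<close>

lemma fourier_coeff_ode:
  assumes u: "T_harmonic 2 u" and r: "\<bar>r\<bar> < 1"
  shows "of_real (1 - r\<^sup>2) * (fourier_coeff k (euler (euler u)) r - (of_int k)\<^sup>2 * fourier_coeff k u r)
       + 4 * of_real (r\<^sup>2) * fourier_coeff k (euler u) r - 4 * of_real (r\<^sup>2) * fourier_coeff k u r = 0"
proof -
  have C2: "Ck_on 2 u (ball 0 1)" using u by (simp add: T_harmonic_def)
  then have C1: "Ck_on 1 u (ball 0 1)" by (rule Ck_on_2_imp_1)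
  note E = Ck_on_1_euler_angular[OF C2 open_ball]
  have cont: "continuous_on (ball 0 1) (euler (euler u))" "continuous_on (ball 0 1) (angular (angular u))"
      "continuous_on (ball 0 1) (euler u)" "continuous_on (ball 0 1) u"
    using E(1,2) C1 by (blast intro: continuous_on_euler_angular Ck_on_1_imp_continuous_on)+
  let ?c = "\<lambda>f t. f (of_real r * cis t) * cis (- (of_int k * t))"
  have "((\<lambda>t. of_real (1 - r\<^sup>2) * (?c (euler (euler u)) t + ?c (angular (angular u)) t)
         + 4 * of_real (r\<^sup>2) * ?c (euler u) t - 4 * of_real (r\<^sup>2) * ?c u t) has_integral
      of_real (1 - r\<^sup>2) * (fourier_coeff k (euler (euler u)) r + fourier_coeff k (angular (angular u)) r)
       + 4 * of_real (r\<^sup>2) * fourier_coeff k (euler u) r - 4 * of_real (r\<^sup>2) * fourier_coeff k u r) {0..2*pi}"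
    by (intro has_integral_diff has_integral_add has_integral_mult_right fourier_coeff_has_integral r cont)
  moreover have "of_real (1 - r\<^sup>2) * (?c (euler (euler u)) t + ?c (angular (angular u)) t)
         + 4 * of_real (r\<^sup>2) * ?c (euler u) t - 4 * of_real (r\<^sup>2) * ?c u t = 0" for t
  proof -
    let ?z = "of_real r * cis t" and ?L = "\<lambda>z. partial_x (partial_x u) z + partial_y (partial_y u) z"
    have z: "(cmod ?z)\<^sup>2 = r\<^sup>2" "cmod ?z < 1" using r by (auto simp: norm_mult)
    have "of_real (1 - r\<^sup>2) * (?c (euler (euler u)) t + ?c (angular (angular u)) t)
         + 4 * of_real (r\<^sup>2) * ?c (euler u) t - 4 * of_real (r\<^sup>2) * ?c u t
      = cis (- (of_int k * t)) * (of_real (1 - r\<^sup>2) * (euler (euler u) ?z + angular (angular u) ?z)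
         + 4 * of_real (r\<^sup>2) * euler u ?z - 4 * of_real (r\<^sup>2) * u ?z)"
      by (simp add: algebra_simps)
    also have "euler (euler u) ?z + angular (angular u) ?z = of_real (r\<^sup>2) * ?L ?z"
      using E(3)[of ?z] z by simp
    also have "of_real (1 - r\<^sup>2) * (of_real (r\<^sup>2) * ?L ?z)
         + 4 * of_real (r\<^sup>2) * euler u ?z - 4 * of_real (r\<^sup>2) * u ?z
       = of_real (r\<^sup>2) * (of_real (1 - r\<^sup>2) * ?L ?z + 4 * euler u ?z - 4 * u ?z)"
      by (simp add: algebra_simps)
    also have "of_real (1 - r\<^sup>2) * ?L ?z + 4 * euler u ?z - 4 * u ?z = 0"
      using T2_harmonic_pde[OF u z(2)] unfolding z(1) .
    finally show ?thesis by simp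
  qed
  ultimately have "((\<lambda>t. 0) has_integral of_real (1 - r\<^sup>2) * (fourier_coeff k (euler (euler u)) r + fourier_coeff k (angular (angular u)) r)
       + 4 * of_real (r\<^sup>2) * fourier_coeff k (euler u) r - 4 * of_real (r\<^sup>2) * fourier_coeff k u r) {0..2*pi}"
    by (simp only:)
  then have "of_real (1 - r\<^sup>2) * (fourier_coeff k (euler (euler u)) r + fourier_coeff k (angular (angular u)) r)
       + 4 * of_real (r\<^sup>2) * fourier_coeff k (euler u) r - 4 * of_real (r\<^sup>2) * fourier_coeff k u r = 0"
    by (metis has_integral_unique has_integral_0)
  moreover have "fourier_coeff k (angular (angular u)) r = - ((of_int k)\<^sup>2 * fourier_coeff k u r)"
    unfolding fourier_coeff_angular[OF C1 r] fourier_coeff_angular[OF E(2) r]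
    by (simp add: power2_eq_square algebra_simps)
  ultimately show ?thesis by simp
qed

section \<open>Regular solutions of the radial equation\<close>

definition radial :: "nat \<Rightarrow> real \<Rightarrow> real" where
  "radial n r = r ^ n - (real n - 1) / (real n + 1) * r ^ (n + 2)"

text \<open>The next two functions arise from \<open>radial n\<close> by applying \<open>r d/dr\<close> once and twice. This
  operator acts diagonally on powers, so no negative exponents occur for small \<open>n\<close>.\<close>

definition radial_euler :: "nat \<Rightarrow> real \<Rightarrow> real" where
  "radial_euler n r = real n * r ^ n - (real n - 1) / (real n + 1) * real (n + 2) * r ^ (n + 2)"

definition radial_euler2 :: "nat \<Rightarrow> real \<Rightarrow> real" where
  "radial_euler2 n r = (real n)\<^sup>2 * r ^ n - (real n - 1) / (real n + 1) * (real (n + 2))\<^sup>2 * r ^ (n + 2)"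

lemma DERIV_power_div:
  fixes r :: real
  assumes "r \<noteq> 0"
  shows "((\<lambda>r. r ^ n) has_field_derivative real n * r ^ n / r) (at r)"
  using DERIV_pow[of n r] assms by (cases n) simp_all

lemma DERIV_radial:
  assumes "r \<noteq> 0"
  shows "(radial n has_field_derivative radial_euler n r / r) (at r)"
    and "(radial_euler n has_field_derivative radial_euler2 n r / r) (at r)"
proof -
  note D = DERIV_power_div[OF assms] DERIV_diff DERIV_cmult
  have "((\<lambda>r. r ^ n - (real n - 1) / (real n + 1) * r ^ (n + 2)) has_field_derivative
      real n * r ^ n / r - (real n - 1) / (real n + 1) * (real (n+2) * r ^ (n+2) / r)) (at r)"
    by (intro D)
  then show "(radial n has_field_derivative radial_euler n r / r) (at r)"
    unfolding radial_def radial_euler_def by (simp only: diff_divide_distrib times_divide_eq_right mult.assoc)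
  have "((\<lambda>r. real n * r ^ n - (real n - 1) / (real n + 1) * real (n+2) * r ^ (n + 2)) has_field_derivative
      real n * (real n * r ^ n / r) - (real n - 1) / (real n + 1) * real (n+2) * (real (n+2) * r ^ (n+2) / r)) (at r)"
    by (intro D)
  then show "(radial_euler n has_field_derivative radial_euler2 n r / r) (at r)"
    unfolding radial_euler2_def radial_euler_def
    by (simp only: diff_divide_distrib times_divide_eq_right mult.assoc power2_eq_square)
qed

text \<open>The polynomial \<open>radial n\<close> is the hypergeometric solution
  \<open>r^n F(-1, n-1; n+1; r\<^sup>2)\<close> of the equation in \<open>fourier_coeff_ode\<close>.\<close>

lemma radial_ode:
  "(1 - r\<^sup>2) * (radial_euler2 n r - (real n)\<^sup>2 * radial n r) + 4 * r\<^sup>2 * radial_euler n r - 4 * r\<^sup>2 * radial n r = 0"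
proof -
  define x where "x = real n"
  define y where "y = (x - 1) / (x + 1)"
  have y: "y * (x + 1) = x - 1" by (simp add: y_def x_def)
  have "radial_euler2 n r - (real n)\<^sup>2 * radial n r = - (4 * (y * (x + 1)) * r\<^sup>2 * r ^ n)"
    unfolding radial_euler2_def radial_def x_def[symmetric] y_def[symmetric]
    by (simp add: x_def[symmetric] power_add algebra_simps power2_eq_square)
  moreover have "radial_euler n r - radial n r = (x - 1 - y * (x + 1) * r\<^sup>2) * r ^ n"
    unfolding radial_euler_def radial_def x_def[symmetric] y_def[symmetric]
    by (simp add: x_def[symmetric] power_add algebra_simps power2_eq_square)
  ultimately have "(1 - r\<^sup>2) * (radial_euler2 n r - (real n)\<^sup>2 * radial n r) + 4 * r\<^sup>2 * (radial_euler n r - radial n r)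
     = (1 - r\<^sup>2) * (- (4 * (x - 1) * r\<^sup>2 * r ^ n)) + 4 * r\<^sup>2 * ((x - 1 - (x - 1) * r\<^sup>2) * r ^ n)"
    by (simp only: y)
  also have "\<dots> = 0" by (simp add: algebra_simps)
  finally have "(1 - r\<^sup>2) * (radial_euler2 n r - (real n)\<^sup>2 * radial n r) + 4 * r\<^sup>2 * (radial_euler n r - radial n r) = 0" .
  then show ?thesis by (simp add: algebra_simps)
qed

lemma radial_pos:
  assumes "0 < r" "r < 1"
  shows "radial n r > 0"
proof -
  have r: "r\<^sup>2 < 1" using assms by (simp add: power_less_one_iff)
  have "(real n - 1) / (real n + 1) * r\<^sup>2 < 1"
  proof (cases "n = 0")
    case False
    have "(real n - 1) / (real n + 1) * r\<^sup>2 \<le> (real n - 1) / (real n + 1) * 1"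
      using False r by (intro mult_left_mono) auto
    also have "\<dots> < 1" by simp
    finally show ?thesis .
  next
    case True
    have "0 \<le> r\<^sup>2" by simp
    then have "- r\<^sup>2 < 1" by linarith
    with True show ?thesis by simp
  qed
  moreover have "radial n r = r ^ n * (1 - (real n - 1) / (real n + 1) * r\<^sup>2)"
    by (simp add: radial_def power_add algebra_simps power2_eq_square)
  ultimately show ?thesis using assms by simp
qed

text \<open>Derivative of the weighted Wronskian: with \<open>w = 1 - r\<^sup>2\<close>, the two hypotheses are the radial
  equation for \<open>(A, B, C)\<close> and for \<open>(p, q, s)\<close>, each triple being a function with its first two
  iterates under \<open>r d/dr\<close>; the conclusion says that the derivative of
  \<open>(A q - B p) / w\<^sup>2\<close>, written out by the product rule, is zero.\<close>

lemma wronskian_algebra: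
  fixes A B C p q s :: "'a::field"
  assumes "r \<noteq> 0" "w \<noteq> 0"
    and "w * (C - k * A) + 4 * r\<^sup>2 * B - 4 * r\<^sup>2 * A = 0"
    and "w * (s - k * p) + 4 * r\<^sup>2 * q - 4 * r\<^sup>2 * p = 0"
  shows "(A * q - B * p) * (4 * r / w ^ 3) + ((A * (s / r) + B / r * q) - (B * (q / r) + C / r * p)) * (1 / w\<^sup>2) = 0"
    (is "?L = 0")
proof -
  have "?L = (w * (A * s - C * p) + 4 * r\<^sup>2 * (A * q - B * p)) / (r * w ^ 3)"
    using assms(1,2) by (simp add: field_simps power2_eq_square power3_eq_cube)
  also have "w * (A * s - C * p) + 4 * r\<^sup>2 * (A * q - B * p)
     = A * (w * (s - k * p) + 4 * r\<^sup>2 * q - 4 * r\<^sup>2 * p) - p * (w * (C - k * A) + 4 * r\<^sup>2 * B - 4 * r\<^sup>2 * A)"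
    by (simp add: algebra_simps)
  finally show ?thesis using assms(3,4) by simp
qed

text \<open>The radial equation has a regular singular point at \<open>0\<close>, where its second solution is
  singular. The weighted Wronskian of the Fourier coefficient and \<open>radial n\<close>
  is constant on \<open>(0,1)\<close>; because \<open>u\<close> is continuously differentiable at the origin, it
  extends continuously by \<open>0\<close>. So it vanishes and the quotient of the two solutions is constant.\<close>

lemma fourier_coeff_eq_radial:
  assumes u: "T_harmonic 2 u"
  obtains c where "\<And>r. 0 < r \<Longrightarrow> r < 1 \<Longrightarrow> fourier_coeff k u r = c * of_real (radial (nat \<bar>k\<bar>) r)"
proof -
  have C2: "Ck_on 2 u (ball 0 1)" using u by (simp add: T_harmonic_def)
  note C1 = Ck_on_2_imp_1[OF C2]
  note E1 = Ck_on_1_euler_angular(1)[OF C2 open_ball]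
  define A where "A = fourier_coeff k u"
  define B where "B = fourier_coeff k (euler u)"
  define C where "C = fourier_coeff k (euler (euler u))"
  define n where "n = nat \<bar>k\<bar>"
  have kn: "(complex_of_int k)\<^sup>2 = of_real ((real n)\<^sup>2)"
    by (simp add: n_def flip: of_int_power)
  let ?p = "\<lambda>r. complex_of_real (radial n r)" and ?q = "\<lambda>r. complex_of_real (radial_euler n r)"
  let ?s = "\<lambda>r. complex_of_real (radial_euler2 n r)"
  have dA: "(A has_vector_derivative B r / of_real r) (at r)"
    and dB: "(B has_vector_derivative C r / of_real r) (at r)"
    and dp: "(?p has_vector_derivative ?q r / of_real r) (at r)"
    and dq: "(?q has_vector_derivative ?s r / of_real r) (at r)" if "0 < r" "r < 1" for r
    using that fourier_coeff_radial_derivative[OF C1 that, of k] fourier_coeff_radial_derivative[OF E1 that, of k]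
      has_vector_derivative_of_real[OF DERIV_radial(1)[of r n], where 'a = complex]
      has_vector_derivative_of_real[OF DERIV_radial(2)[of r n], where 'a = complex]
    by (auto simp: A_def B_def C_def)
  define q where "q r = (A r * ?q r - B r * ?p r) * of_real (1 / (1 - r\<^sup>2)\<^sup>2)" for r
  have dq0: "(q has_vector_derivative 0) (at r)" if r: "0 < r" "r < 1" for r
  proof -
    have w0: "1 - r\<^sup>2 \<noteq> 0" using r by (simp add: power2_eq_1_iff)
    have "((\<lambda>r. 1 / (1 - r\<^sup>2)\<^sup>2) has_field_derivative 4 * r / (1 - r\<^sup>2) ^ 3) (at r)"
    proof (rule derivative_eq_intros refl | simp add: w0)+
      have "(0 * w\<^sup>2 - 1 * (real 2 * ((0 - real 2 * (1 * r ^ (2 - Suc 0))) * w ^ (2 - Suc 0)))) / (w\<^sup>2 * w\<^sup>2)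
          = 4 * r / w ^ 3" if "w \<noteq> 0" for w
        using that by (simp add: field_simps power2_eq_square power3_eq_cube)
      from this[OF w0] show "(0 * (1 - r\<^sup>2)\<^sup>2 - 1 * (real 2 * ((0 - real 2 * (1 * r ^ (2 - Suc 0))) *
          (1 - r\<^sup>2) ^ (2 - Suc 0)))) / ((1 - r\<^sup>2)\<^sup>2 * (1 - r\<^sup>2)\<^sup>2) = 4 * r / (1 - r\<^sup>2) ^ 3" .
    qed (use w0 in simp)
    then have "((\<lambda>r. complex_of_real (1 / (1 - r\<^sup>2)\<^sup>2)) has_vector_derivative of_real (4 * r / (1 - r\<^sup>2) ^ 3)) (at r)"
      by (rule has_vector_derivative_of_real)
    then have "(q has_vector_derivative
        (A r * ?q r - B r * ?p r) * of_real (4 * r / (1 - r\<^sup>2) ^ 3)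
        + ((A r * (?s r / of_real r) + B r / of_real r * ?q r)
           - (B r * (?q r / of_real r) + C r / of_real r * ?p r)) * of_real (1 / (1 - r\<^sup>2)\<^sup>2)) (at r)"
      unfolding q_def by (intro has_vector_derivative_mult has_vector_derivative_diff dA dB dp dq r)
    moreover have "(A r * ?q r - B r * ?p r) * (4 * of_real r / (of_real (1 - r\<^sup>2)) ^ 3)
        + ((A r * (?s r / of_real r) + B r / of_real r * ?q r)
           - (B r * (?q r / of_real r) + C r / of_real r * ?p r)) * (1 / (of_real (1 - r\<^sup>2))\<^sup>2) = 0"
    proof (rule wronskian_algebra[where k = "of_real ((real n)\<^sup>2)"])
      show "complex_of_real (1 - r\<^sup>2) \<noteq> 0" using w0 by (simp only: of_real_eq_0_iff not_False_eq_True)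
      show "of_real (1 - r\<^sup>2) * (C r - of_real ((real n)\<^sup>2) * A r)
         + 4 * (complex_of_real r)\<^sup>2 * B r - 4 * (complex_of_real r)\<^sup>2 * A r = 0"
        using fourier_coeff_ode[OF u, of r k] r unfolding A_def B_def C_def kn by simp
      show "of_real (1 - r\<^sup>2) * (?s r - of_real ((real n)\<^sup>2) * ?p r)
         + 4 * (complex_of_real r)\<^sup>2 * ?q r - 4 * (complex_of_real r)\<^sup>2 * ?p r = 0"
        using arg_cong[OF radial_ode[of r n], of complex_of_real] by simp
    qed (use r in auto)
    ultimately show ?thesis by simp
  qed
  have q0: "q r = 0" if r: "0 < r" "r < 1" for r
  proof (rule has_derivative_zero_unique_strong_interval[where k = "{0}" and a = 0 and b = r])
    have "continuous_on {0..r} A" "continuous_on {0..r} B"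
      unfolding A_def B_def
      by (rule continuous_on_subset[OF continuous_on_fourier_coeff], (use r in \<open>auto intro:
         Ck_on_1_imp_continuous_on[OF C1] Ck_on_1_imp_continuous_on[OF E1]\<close>))+
    moreover have "continuous_on {0..r} (\<lambda>r. 1 / (1 - r\<^sup>2)\<^sup>2)"
    proof (intro continuous_intros ballI)
      fix x assume "x \<in> {0..r}"
      then have "x\<^sup>2 < 1" using r by (auto simp: power_less_one_iff)
      then show "(1 - x\<^sup>2)\<^sup>2 \<noteq> 0" by simp
    qed
    moreover have "continuous_on {0..r} (radial n)" "continuous_on {0..r} (radial_euler n)"
      unfolding radial_def radial_euler_def by (intro continuous_intros)+
    ultimately show "continuous_on {0..r} q"
      unfolding q_def by (intro continuous_on_mult continuous_on_diff continuous_on_of_real)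
    \<comment> \<open>\<open>B\<close> vanishes at \<open>0\<close> because \<open>euler u 0 = 0\<close>, and \<open>radial_euler n 0 = 0\<close> also for \<open>n = 0\<close>\<close>
    have "B 0 = 0" by (simp add: B_def fourier_coeff_def euler_def)
    moreover have "radial_euler n 0 = 0" by (cases n) (simp_all add: radial_euler_def)
    ultimately show "q 0 = 0" by (simp add: q_def)
    show "(q has_derivative (\<lambda>h. 0)) (at x within {0..r})" if "x \<in> {0..r} - {0}" for x
      using dq0[of x] that r by (auto simp: has_vector_derivative_def intro: has_derivative_at_withinI)
  qed (use r in auto)
  \<comment> \<open>the vanishing Wronskian is the numerator of the derivative of the quotient\<close>
  have "\<exists>c. \<forall>r\<in>{0<..<1}. A r / ?p r = c"
  proof (rule has_vector_derivative_zero_constant)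
    fix r :: real assume "r \<in> {0<..<1}"
    then have r: "0 < r" "r < 1" by auto
    have "1 - r\<^sup>2 \<noteq> 0" using r by (simp add: power2_eq_1_iff)
    then have "A r * ?q r - B r * ?p r = 0" using q0[OF r] unfolding q_def
      by (simp only: mult_eq_0_iff of_real_eq_0_iff divide_eq_0_iff power_eq_0_iff) simp
    moreover have p0: "radial n r \<noteq> 0" using radial_pos[OF r, of n] by simp
    ultimately have e: "- (A r * (?q r / of_real r)) * (1 / (?p r)\<^sup>2) + B r / of_real r * (1 / ?p r) = 0"
      using r by (simp add: field_simps power2_eq_square)
    have "((\<lambda>r. 1 / radial n r) has_field_derivative - (radial_euler n r / r * (1 / (radial n r)\<^sup>2))) (at r)"
      by (rule derivative_eq_intros DERIV_radial refl | use p0 r in \<open>simp add: field_simps power2_eq_square\<close>)+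
    then have "((\<lambda>r. complex_of_real (1 / radial n r)) has_vector_derivative of_real (- (radial_euler n r / r * (1 / (radial n r)\<^sup>2)))) (at r)"
      by (rule has_vector_derivative_of_real)
    from has_vector_derivative_mult[OF dA[OF r] this]
    have "((\<lambda>r. A r / ?p r) has_vector_derivative 0) (at r)"
      using e by (simp add: field_simps)
    then show "((\<lambda>r. A r / ?p r) has_vector_derivative 0) (at r within {0<..<1})"
      by (rule has_vector_derivative_at_within)
  qed auto
  then obtain c where c: "\<And>r. 0 < r \<Longrightarrow> r < 1 \<Longrightarrow> A r / ?p r = c" by auto
  show thesis
  proof
    fix r :: real assume r: "0 < r" "r < 1"
    then show "fourier_coeff k u r = c * of_real (radial (nat \<bar>k\<bar>) r)"
      using c[OF r] radial_pos[OF r, of n] by (auto simp: A_def n_def field_simps)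
  qed
qed

section \<open>Size of the Fourier coefficients\<close>

text \<open>On a half period starting at \<open>a\<close> the cosine changes its sign exactly once, at the point
  \<open>b + \<pi>/2\<close> where \<open>b\<close> is the multiple of \<open>\<pi>\<close> nearest to \<open>a\<close>.\<close>

lemma has_integral_abs_cos_half_period:
  "((\<lambda>x. \<bar>cos x\<bar>) has_integral 2) {a..a+pi}"
proof -
  define n where "n = \<lfloor>a / pi + 1/2\<rfloor>"
  define b where "b = of_int n * pi"
  have "of_int n \<le> a / pi + 1/2" "a / pi + 1/2 < of_int n + 1"
    unfolding n_def by linarith+
  then have ab: "b - pi/2 \<le> a" "a < b + pi/2"
    unfolding b_def by (auto simp: field_simps)
  have cos_b: "\<bar>cos x\<bar> = \<bar>cos (x - b)\<bar>" for x
    using cos_npi_int[of n] sin_npi_int[of n]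
    by (simp add: b_def cos_diff mult.commute abs_mult)
  have "((\<lambda>x. \<bar>cos x\<bar>) has_integral sin (b + pi/2 - b) - sin (a - b)) {a..b + pi/2}"
  proof (rule has_integral_eq)
    show "((\<lambda>x. cos (x - b)) has_integral sin (b + pi/2 - b) - sin (a - b)) {a..b + pi/2}"
      by (rule fundamental_theorem_of_calculus)
         (use ab in \<open>auto intro!: derivative_eq_intros simp: has_real_derivative_iff_has_vector_derivative[symmetric]\<close>)
    show "cos (x - b) = \<bar>cos x\<bar>" if "x \<in> {a..b + pi/2}" for x
      using that ab cos_ge_zero[of "x - b"] by (auto simp: cos_b[of x])
  qed
  moreover have "((\<lambda>x. \<bar>cos x\<bar>) has_integral - sin (a + pi - b) - - sin (b + pi/2 - b)) {b + pi/2..a + pi}"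
  proof (rule has_integral_eq)
    show "((\<lambda>x. - cos (x - b)) has_integral - sin (a + pi - b) - - sin (b + pi/2 - b)) {b + pi/2..a+pi}"
      by (rule fundamental_theorem_of_calculus)
         (use ab in \<open>auto intro!: derivative_eq_intros simp: has_real_derivative_iff_has_vector_derivative[symmetric]\<close>)
    show "- cos (x - b) = \<bar>cos x\<bar>" if "x \<in> {b + pi/2..a + pi}" for x
      using that ab cos_ge_zero[of "x - b - pi"] by (auto simp: cos_b[of x])
  qed
  ultimately have "((\<lambda>x. \<bar>cos x\<bar>) has_integral (sin (b + pi/2 - b) - sin (a - b)) +
      (- sin (a + pi - b) - - sin (b + pi/2 - b))) {a..a+pi}"
    by (rule has_integral_combine[rotated 2]) (use ab in auto)
  moreover have "sin (a + pi - b) = - sin (a - b)"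
    using sin_periodic_pi[of "a - b"] by (simp add: algebra_simps)
  ultimately show ?thesis by simp
qed

lemma has_integral_abs_cos_full_period:
  assumes "k \<noteq> 0"
  shows "((\<lambda>t. \<bar>cos (real k * t + c)\<bar>) has_integral 4) {0..2*pi}"
proof -
  have *: "((\<lambda>x. \<bar>cos x\<bar>) has_integral 2 * real m) {c..c + real m * pi}" for m
  proof (induction m)
    case 0
    show ?case by (simp add: has_integral_refl)
  next
    case (Suc m)
    have "((\<lambda>x. \<bar>cos x\<bar>) has_integral 2 * real m + 2) {c..c + real m * pi + pi}"
      by (rule has_integral_combine[OF _ _ Suc has_integral_abs_cos_half_period]) auto
    then show ?case by (simp add: algebra_simps)
  qed
  have "((\<lambda>t. \<bar>cos (real k *\<^sub>R t + c)\<bar>) has_integral (2 * real (2*k)) /\<^sub>R real k ^ DIM(real))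
     (cbox ((c - c) /\<^sub>R real k) ((c + real (2*k) * pi - c) /\<^sub>R real k))"
    by (rule has_integral_affinity') (use *[of "2 * k"] assms in auto)
  then show ?thesis using assms by (simp add: field_simps)
qed

text \<open>Rotating both coefficients onto the positive axis turns their sum of moduli into a single
  integral of \<open>f\<close> against \<open>2 cos (k t + c)\<close>, up to unimodular factors. This is sharper than the
  two separate bounds \<open>2 \<pi> M\<close>.\<close>

lemma fourier_coeff_pair_bound:
  assumes f: "continuous_on (ball 0 1) f" and M: "\<And>z. cmod z < 1 \<Longrightarrow> cmod (f z) \<le> M"
    and r: "\<bar>r\<bar> < 1" and k: "k \<noteq> 0"
  shows "cmod (fourier_coeff (int k) f r) + cmod (fourier_coeff (- int k) f r) \<le> 8 * M"
proof -
  define x where "x = - Arg (fourier_coeff (int k) f r)"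
  define y where "y = - Arg (fourier_coeff (- int k) f r)"
  have x: "cis x * fourier_coeff (int k) f r = of_real (cmod (fourier_coeff (int k) f r))"
    by (subst (2) rcis_cmod_Arg[symmetric]) (simp add: x_def rcis_def cis_mult)
  have y: "cis y * fourier_coeff (- int k) f r = of_real (cmod (fourier_coeff (- int k) f r))"
    by (subst (2) rcis_cmod_Arg[symmetric]) (simp add: y_def rcis_def cis_mult)
  let ?u = "\<lambda>t. f (of_real r * cis t)"
  let ?g = "\<lambda>t. cis x * (?u t * cis (- (of_int (int k) * t))) + cis y * (?u t * cis (- (of_int (- int k) * t)))"
  have "(?g has_integral (cis x * fourier_coeff (int k) f r + cis y * fourier_coeff (- int k) f r)) {0..2*pi}"
    by (intro has_integral_add has_integral_mult_right fourier_coeff_has_integral f r)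
  moreover have "((\<lambda>t. 2 * M * \<bar>cos (real k * t + (y - x) / 2)\<bar>) has_integral 2 * M * 4) {0..2*pi}"
    by (intro has_integral_mult_right has_integral_abs_cos_full_period k)
  moreover have "cmod (?g t) \<le> 2 * M * \<bar>cos (real k * t + (y - x) / 2)\<bar>" for t
  proof -
    have "cis (x - k * t) = cis x * cis (- (k * t))" "cis (y + k * t) = cis y * cis (k * t)"
      by (simp_all add: cis_mult)
    then have "?g t = ?u t * (cis (x - k * t) + cis (y + k * t))"
      by (simp add: algebra_simps)
    also have "cis (x - k * t) + cis (y + k * t)
       = cis ((x + y) / 2) * (cis (- (k * t + (y - x) / 2)) + cis (k * t + (y - x) / 2))"
    proof -
      have "x - k * t = (x + y) / 2 + - (k * t + (y - x) / 2)" "y + k * t = (x + y) / 2 + (k * t + (y - x) / 2)"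
        by (simp_all add: field_simps)
      then show ?thesis by (simp only: distrib_left cis_mult)
    qed
    also have "cis (- (k * t + (y - x) / 2)) + cis (k * t + (y - x) / 2) = of_real (2 * cos (k * t + (y - x) / 2))"
      using complex_add_cnj[of "cis (k * t + (y - x) / 2)"] by (simp only: cis_cnj cis.sel add.commute)
    finally have "cmod (?g t) = cmod (?u t) * (2 * \<bar>cos (k * t + (y - x) / 2)\<bar>)"
      by (simp add: norm_mult abs_mult del: of_real_mult)
    also have "\<dots> \<le> M * (2 * \<bar>cos (k * t + (y - x) / 2)\<bar>)"
      using M[of "of_real r * cis t"] r by (intro mult_right_mono) (auto simp: norm_mult)
    finally show ?thesis by simp
  qed
  ultimately have "cmod (cis x * fourier_coeff (int k) f r + cis y * fourier_coeff (- int k) f r) \<le> 2 * M * 4"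
    by (metis (no_types, lifting) has_integral_integrable integral_norm_bound_integral integral_unique)
  moreover have "cmod (fourier_coeff (int k) f r) + cmod (fourier_coeff (- int k) f r)
     = cmod (cis x * fourier_coeff (int k) f r + cis y * fourier_coeff (- int k) f r)"
    unfolding x y by (simp flip: of_real_add)
  ultimately show ?thesis by simp
qed

section \<open>Completeness of the trigonometric system\<close>

definition null_fourier :: "(complex \<Rightarrow> complex) \<Rightarrow> bool" where
  "null_fourier f \<longleftrightarrow> continuous_on (sphere 0 1) f \<and>
     (\<forall>k::int. ((\<lambda>t. f (cis t) * cis (- (of_int k * t))) has_integral 0) {0..2*pi})"

text \<open>Multiplication by \<open>Re w\<close> or \<open>Im w\<close> on the unit circle only shifts Fourier indices by one in
  both directions, so the functions with vanishing Fourier coefficients are closed under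
  multiplication by real polynomials in the coordinates.\<close>

lemma null_fourier_mult_polynomial:
  assumes "real_polynomial_function p" "null_fourier f"
  shows "null_fourier (\<lambda>w. of_real (p w) * f w)"
  using assms
proof (induction arbitrary: f)
  case (linear p)
  note p_linear = linear(1) and f_null = linear(2)
  interpret bounded_linear p by (fact p_linear)
  define a where "a = complex_of_real (p 1)"
  define b where "b = complex_of_real (p \<i>)"
  have p: "of_real (p (cis t)) = (a - \<i> * b) / 2 * cis t + (a + \<i> * b) / 2 * cis (- t)" for t
  proof -
    have "cis t = cos t *\<^sub>R 1 + sin t *\<^sub>R \<i>" by (simp add: complex_eq_iff)
    then have "p (cis t) = cos t *\<^sub>R p 1 + sin t *\<^sub>R p \<i>" by (simp only: add scaleR)
    then show ?thesis by (simp add: a_def b_def complex_eq_iff field_simps)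
  qed
  have "continuous_on (sphere 0 1) f" using f_null by (simp add: null_fourier_def)
  moreover have "continuous_on (sphere 0 1) p"
    by (intro linear_continuous_on) (fact p_linear)
  moreover have "((\<lambda>t. of_real (p (cis t)) * f (cis t) * cis (- (of_int k * t))) has_integral 0) {0..2*pi}" for k :: int
  proof -
    have "((\<lambda>t. (a - \<i> * b) / 2 * (f (cis t) * cis (- (of_int (k - 1) * t)))
        + (a + \<i> * b) / 2 * (f (cis t) * cis (- (of_int (k + 1) * t)))) has_integral
        (a - \<i> * b) / 2 * 0 + (a + \<i> * b) / 2 * 0) {0..2*pi}"
      using f_null unfolding null_fourier_def
      by (intro has_integral_add has_integral_mult_right) blast+
    moreover have "of_real (p (cis t)) * f (cis t) * cis (- (of_int k * t)) =
        (a - \<i> * b) / 2 * (f (cis t) * cis (- (of_int (k - 1) * t)))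
        + (a + \<i> * b) / 2 * (f (cis t) * cis (- (of_int (k + 1) * t)))" for t
    proof -
      have "cis (- (of_int (k - 1) * t)) = cis t * cis (- (of_int k * t))"
           "cis (- (of_int (k + 1) * t)) = cis (- t) * cis (- (of_int k * t))"
        by (simp_all add: cis_mult algebra_simps)
      then show ?thesis unfolding p by (simp only:) (simp add: algebra_simps)
    qed
    ultimately show ?thesis by simp
  qed
  ultimately show ?case
    unfolding null_fourier_def by (auto intro!: continuous_intros)
next
  case (const c)
  then show ?case
    unfolding null_fourier_def mult.assoc
    by (auto intro!: continuous_intros has_integral_mult_right[of _ 0, simplified])
next
  case (add p q)
  have "null_fourier (\<lambda>w. of_real (p w) * f w)" "null_fourier (\<lambda>w. of_real (q w) * f w)"
    using add by auto
  then show ?case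
    unfolding null_fourier_def
    by (auto simp: distrib_right intro!: continuous_on_add has_integral_add[of _ 0 _ _ 0, simplified])
next
  case (mult p q)
  have "null_fourier (\<lambda>w. of_real (p w) * (of_real (q w) * f w))"
    using mult by auto
  then show ?case by (simp add: mult.assoc)
qed

text \<open>By Stone--Weierstrass the conjugate of \<open>f\<close> is uniformly close to a polynomial \<open>P\<close>, and
  \<open>f P\<close> has integral zero. Hence the integral of \<open>|f|\<^sup>2\<close> is arbitrarily small.\<close>

lemma null_fourier_imp_zero:
  assumes f: "null_fourier f" and w: "cmod w = 1"
  shows "f w = 0"
proof -
  have cont: "continuous_on (sphere 0 1) f" using f by (simp add: null_fourier_def)
  have contt: "continuous_on {0..2*pi} (\<lambda>t. f (cis t))"
    by (rule continuous_on_compose2[OF cont]) (auto intro!: continuous_intros)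
  obtain B where B: "\<And>z. cmod z = 1 \<Longrightarrow> cmod (f z) \<le> B"
    using compact_imp_bounded[OF compact_continuous_image[OF cont compact_sphere]]
    unfolding bounded_iff by (metis imageI mem_sphere_0)
  have B0: "B \<ge> 0" using B[of 1] norm_ge_zero[of "f 1"] by (simp del: norm_ge_zero)
  let ?h = "\<lambda>t. (cmod (f (cis t)))\<^sup>2"
  have int_h: "?h integrable_on {0..2*pi}"
    by (intro integrable_continuous_real continuous_intros contt)
  have small: "integral {0..2*pi} ?h \<le> 2 * e * B * (2 * pi)" if e: "e > 0" for e
  proof -
    obtain p where p: "real_polynomial_function p" "\<And>z. z \<in> sphere 0 1 \<Longrightarrow> \<bar>Re (f z) - p z\<bar> < e"
      using Stone_Weierstrass_real_polynomial_function[OF compact_sphere continuous_on_Re[OF cont] e] by blast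
    obtain q where q: "real_polynomial_function q" "\<And>z. z \<in> sphere 0 1 \<Longrightarrow> \<bar>Im (f z) - q z\<bar> < e"
      using Stone_Weierstrass_real_polynomial_function[OF compact_sphere continuous_on_Im[OF cont] e] by blast
    let ?g = "\<lambda>t. complex_of_real (?h t) - (of_real (p (cis t)) * f (cis t) - \<i> * (of_real (q (cis t)) * f (cis t)))"
    have z: "((\<lambda>t. of_real (s (cis t)) * f (cis t)) has_integral 0) {0..2*pi}"
      if "real_polynomial_function s" for s
      using null_fourier_mult_polynomial[OF that f] unfolding null_fourier_def
      by (auto dest!: spec[of _ 0])
    have "(?g has_integral of_real (integral {0..2*pi} ?h) - (0 - \<i> * 0)) {0..2*pi}"
      by (intro has_integral_diff has_integral_mult_right z p q has_integral_of_real integrable_integral int_h)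
    then have g: "(?g has_integral of_real (integral {0..2*pi} ?h)) {0..2*pi}" by simp
    have "cmod (?g t) \<le> 2 * e * B" for t
    proof -
      have "?g t = f (cis t) * (cnj (f (cis t)) - (of_real (p (cis t)) - \<i> * of_real (q (cis t))))"
        unfolding complex_norm_square by (simp add: algebra_simps)
      moreover have "cmod (cnj (f (cis t)) - (of_real (p (cis t)) - \<i> * of_real (q (cis t)))) \<le>
          \<bar>Re (f (cis t)) - p (cis t)\<bar> + \<bar>Im (f (cis t)) - q (cis t)\<bar>"
        using cmod_le[of "cnj (f (cis t)) - (of_real (p (cis t)) - \<i> * of_real (q (cis t)))"] by simp
      moreover have "\<dots> \<le> 2 * e" using p(2)[of "cis t"] q(2)[of "cis t"] by simp
      ultimately show ?thesis
        using mult_mono[OF B[of "cis t"], of "cmod (cnj (f (cis t)) - (of_real (p (cis t)) - \<i> * of_real (q (cis t))))" "2 * e"] B0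
        by (simp add: norm_mult mult.commute)
    qed
    then have "cmod (of_real (integral {0..2*pi} ?h)) \<le> 2 * e * B * (2 * pi)"
      using has_integral_bound[of "2 * e * B" ?g "of_real (integral {0..2*pi} ?h)" 0 "2*pi"] g e B0
      by (simp del: norm_of_real)
    then show ?thesis by (simp only: norm_of_real abs_le_iff)
  qed
  have "integral {0..2*pi} ?h \<le> 0"
  proof (rule field_le_epsilon)
    fix e :: real assume e: "e > 0"
    define d where "d = e / (4 * pi * (B + 1))"
    have "d > 0" using e B0 by (simp add: d_def)
    have "integral {0..2*pi} ?h \<le> 2 * d * B * (2 * pi)" by (rule small) fact
    also have "\<dots> \<le> 2 * d * (B + 1) * (2 * pi)" using \<open>d > 0\<close> by (intro mult_right_mono mult_left_mono) auto
    also have "\<dots> = d * (4 * pi * (B + 1))" by simp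
    also have "\<dots> = e" using B0 by (simp add: d_def)
    finally show "integral {0..2*pi} ?h \<le> 0 + e" by simp
  qed
  moreover have "integral {0..2*pi} ?h \<ge> 0" by (intro integral_nonneg int_h) auto
  ultimately have "(?h has_integral 0) (cbox 0 (2*pi))"
    using integrable_integral[OF int_h] by simp
  moreover obtain t where t: "0 \<le> t" "t < 2*pi" "w = cis t"
    using w Arg2pi[of w] by (auto simp: complex_norm_eq_1_exp cis_conv_exp)
  ultimately have "?h t = 0"
    by (intro has_integral_0_cbox_imp_0[of 0 "2*pi" ?h]) (auto intro!: continuous_intros contt simp: box_real)
  then show ?thesis using t by simp
qed

section \<open>Expansion into modes\<close>

text \<open>On the circle of radius \<open>r\<close> this is \<open>radial n r\<close> times a combination of the two trigonometric
  functions of frequencies \<open>n\<close> and \<open>- n\<close>. The factor \<open>r^n\<close> is absorbed in the powers of \<open>z\<close>, which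
  makes smoothness at the origin evident.\<close>

definition mode_pair :: "nat \<Rightarrow> complex \<Rightarrow> complex \<Rightarrow> complex \<Rightarrow> complex" where
  "mode_pair n a b z = (a * z ^ n + b * cnj z ^ n) * of_real (1 - (real n - 1) / (real n + 1) * (cmod z)\<^sup>2)"

lemma mode_pair_polar:
  "mode_pair n a b (of_real r * cis t) = of_real (radial n r) * (a * cis (real n * t) + b * cis (- (real n * t)))"
proof -
  have "cnj (of_real r * cis t) ^ n = of_real (r ^ n) * cis (- (real n * t))"
    using Complex.DeMoivre[of "- t" n] by (simp add: power_mult_distrib cis_cnj)
  moreover have "(of_real r * cis t) ^ n = of_real (r ^ n) * cis (real n * t)"
    by (simp add: power_mult_distrib Complex.DeMoivre)
  moreover have "(cmod (of_real r * cis t))\<^sup>2 = r\<^sup>2" by (simp add: norm_mult)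
  moreover have "radial n r = r ^ n * (1 - (real n - 1) / (real n + 1) * r\<^sup>2)"
    by (simp add: radial_def power_add algebra_simps power2_eq_square)
  ultimately show ?thesis
    unfolding mode_pair_def by (simp only: of_real_mult) (simp only: algebra_simps)
qed

text \<open>For \<open>n \<ge> 1\<close> the radial factor \<open>1 - (n-1)/(n+1) * |z|\<^sup>2\<close> lies between \<open>0\<close> and \<open>1\<close>; for
  \<open>n = 0\<close> it would be \<open>1 + |z|\<^sup>2\<close>.\<close>

lemma norm_mode_pair_le:
  assumes "n \<ge> 1" "cmod z \<le> s" "s < 1"
  shows "cmod (mode_pair n a b z) \<le> (cmod a + cmod b) * s ^ n"
proof -
  let ?w = "1 - (real n - 1) / (real n + 1) * (cmod z)\<^sup>2"
  have "(real n - 1) / (real n + 1) * (cmod z)\<^sup>2 \<le> 1 * 1"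
    using assms by (intro mult_mono) (auto simp: abs_square_le_1 power_le_one)
  then have w: "\<bar>?w\<bar> \<le> 1" using assms by (auto simp: abs_le_iff)
  have "cmod (a * z ^ n + b * cnj z ^ n) \<le> cmod a * cmod z ^ n + cmod b * cmod z ^ n"
    by (rule norm_triangle_le) (simp add: norm_mult norm_power)
  also have "\<dots> \<le> (cmod a + cmod b) * s ^ n"
    using power_mono[OF assms(2), of n] by (auto simp: distrib_right intro!: add_mono mult_left_mono)
  finally have "cmod (mode_pair n a b z) \<le> (cmod a + cmod b) * s ^ n * 1"
    unfolding mode_pair_def norm_mult norm_of_real
    using w by (intro mult_mono) (auto intro: order_trans[OF norm_ge_zero])
  then show ?thesis by simp
qed

lemma has_integral_cis_multiple:
  "((\<lambda>t. cis (of_int m * t)) has_integral (if m = 0 then 2 * of_real pi else 0)) {0..2*pi}"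
proof (cases "m = 0")
  case True
  then show ?thesis using has_integral_const_real[of "1::complex" 0 "2*pi"] by (simp add: scaleR_conv_of_real)
next
  case False
  have "((\<lambda>t. cis (of_int m * t)) has_integral
     cis (of_int m * (2*pi)) / (\<i> * of_int m) - cis (of_int m * 0) / (\<i> * of_int m)) {0..2*pi}"
  proof (rule fundamental_theorem_of_calculus)
    fix t :: real
    show "((\<lambda>t. cis (of_int m * t) / (\<i> * of_int m)) has_vector_derivative cis (of_int m * t)) (at t within {0..2*pi})"
      unfolding has_vector_derivative_def using False
      by (auto intro!: derivative_eq_intros simp: scaleR_conv_of_real complex_eq_iff fun_eq_iff)
  qed simp
  moreover have "cis (of_int m * (2*pi)) = 1"
    using cis_multiple_2pi[of "of_int m"] by (simp add: mult_ac)
  ultimately show ?thesis using False by simp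
qed

lemma has_integral_mode_pair:
  "((\<lambda>t. mode_pair n a b (of_real r * cis t) * cis (- (of_int k * t))) has_integral
     2 * of_real pi * of_real (radial n r) * ((if int n = k then a else 0) + (if - int n = k then b else 0))) {0..2*pi}"
proof -
  have eq: "mode_pair n a b (of_real r * cis t) * cis (- (of_int k * t)) =
     of_real (radial n r) * (a * cis (of_int (int n - k) * t) + b * cis (of_int (- int n - k) * t))" for t
  proof -
    have "cis (of_int (int n - k) * t) = cis (real n * t) * cis (- (of_int k * t))"
      "cis (of_int (- int n - k) * t) = cis (- (real n * t)) * cis (- (of_int k * t))"
      by (simp_all add: cis_mult left_diff_distrib)
    then show ?thesis unfolding mode_pair_polar by (simp only:) (simp only: algebra_simps)
  qed
  have "((\<lambda>t. of_real (radial n r) * (a * cis (of_int (int n - k) * t) + b * cis (of_int (- int n - k) * t))) has_integral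
     of_real (radial n r) * (a * (if int n - k = 0 then 2 * of_real pi else 0)
        + b * (if - int n - k = 0 then 2 * of_real pi else 0))) {0..2*pi}"
    by (intro has_integral_mult_right has_integral_add has_integral_cis_multiple)
  then show ?thesis unfolding eq
    by (rule back_subst[of "\<lambda>i. (_ has_integral i) _"]) (auto simp: algebra_simps)
qed

lemma summable_mode_majorant:
  fixes s :: real
  assumes "0 \<le> s" "s < 1"
  shows "summable (\<lambda>n. K * (real n + 2) * s ^ Suc n)"
proof -
  have "(\<lambda>n. of_nat (Suc n) * s ^ n) sums (1 / (1 - s)\<^sup>2)"
    by (rule geometric_deriv_sums) (use assms in auto)
  then have "summable (\<lambda>n. K * s * ((of_nat (Suc n) * s ^ n) + s ^ n))"
    using assms by (intro summable_mult summable_add summable_geometric) (auto simp: sums_iff)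
  moreover have "(\<lambda>n. K * s * ((of_nat (Suc n) * s ^ n) + s ^ n)) = (\<lambda>n. K * (real n + 2) * s ^ Suc n)"
    by (auto simp: algebra_simps)
  ultimately show ?thesis by (simp only:)
qed

text \<open>The coefficient bound comes from the limit \<open>r \<rightarrow> 1\<close>, where
  \<open>radial n\<close> takes the value \<open>2/(n+1)\<close>; the zeroth coefficient is identified by the limit
  \<open>r \<rightarrow> 0\<close>.\<close>

lemma T2_harmonic_coefficients:
  assumes u: "T_harmonic 2 u" and M: "\<And>z. cmod z < 1 \<Longrightarrow> cmod (u z) \<le> M"
  obtains c :: "int \<Rightarrow> complex" where
    "\<And>k r. 0 < r \<Longrightarrow> r < 1 \<Longrightarrow> fourier_coeff k u r = 2 * of_real pi * of_real (radial (nat \<bar>k\<bar>) r) * c k"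
    "\<And>n. n \<ge> 1 \<Longrightarrow> cmod (c (int n)) + cmod (c (- int n)) \<le> 2 * (real n + 1) * M / pi"
    "c 0 = u 0"
proof -
  have cont: "continuous_on (ball 0 1) u"
    using u by (auto simp: T_harmonic_def dest!: Ck_on_2_imp_1 Ck_on_1_imp_continuous_on)
  have "\<exists>c. \<forall>r. 0 < r \<and> r < 1 \<longrightarrow> fourier_coeff k u r = 2 * of_real pi * of_real (radial (nat \<bar>k\<bar>) r) * c" for k
  proof -
    obtain d where "\<And>r. 0 < r \<Longrightarrow> r < 1 \<Longrightarrow> fourier_coeff k u r = d * of_real (radial (nat \<bar>k\<bar>) r)"
      using fourier_coeff_eq_radial[OF u] by metis
    then show ?thesis by (intro exI[of _ "d / (2 * of_real pi)"]) auto
  qed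
  then obtain c where c: "\<And>k r. 0 < r \<Longrightarrow> r < 1 \<Longrightarrow>
      fourier_coeff k u r = 2 * of_real pi * of_real (radial (nat \<bar>k\<bar>) r) * c k"
    by metis
  have cont_radial: "isCont (radial n) r" for n r
    unfolding radial_def by (intro continuous_intros)
  have lim: "(f \<longlongrightarrow> f x) (at x within S)" if "isCont f x"
    for f :: "real \<Rightarrow> complex" and x S
    using continuous_at_imp_continuous_at_within[OF that] by (simp add: continuous_within)
  have lim_real: "(f \<longlongrightarrow> f x) (at x within S)" if "isCont f x" for f :: "real \<Rightarrow> real" and x S
    using continuous_at_imp_continuous_at_within[OF that] by (simp add: continuous_within)
  have bound: "cmod (c (int n)) + cmod (c (- int n)) \<le> 2 * (real n + 1) * M / pi" if n: "n \<ge> 1" for n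
  proof -
    let ?C = "cmod (c (int n)) + cmod (c (- int n))"
    have "2 * pi * radial n 1 * ?C \<le> 8 * M"
    proof (rule tendsto_upperbound)
      show "((\<lambda>r. 2 * pi * radial n r * ?C) \<longlongrightarrow> 2 * pi * radial n 1 * ?C) (at_left 1)"
        by (intro tendsto_intros lim_real cont_radial)
      have "eventually (\<lambda>r::real. r \<in> {0<..<1}) (at_left 1)"
        by (rule eventually_at_left_real) simp
      then show "eventually (\<lambda>r. 2 * pi * radial n r * ?C \<le> 8 * M) (at_left 1)"
      proof eventually_elim
        case (elim r)
        then have r: "0 < r" "r < 1" by auto
        have "2 * pi * radial n r * ?C = cmod (fourier_coeff (int n) u r) + cmod (fourier_coeff (- int n) u r)"
          using c[OF r] radial_pos[OF r, of n] by (simp add: norm_mult algebra_simps)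
        also have "\<dots> \<le> 8 * M"
          by (rule fourier_coeff_pair_bound) (use cont M r n in auto)
        finally show ?case .
      qed
    qed simp
    moreover have "radial n 1 = 2 / (real n + 1)" by (simp add: radial_def field_simps)
    ultimately show ?thesis by (simp add: field_simps)
  qed
  have "c 0 = u 0"
  proof -
    have "(fourier_coeff 0 u \<longlongrightarrow> fourier_coeff 0 u 0) (at_right 0)"
    proof -
      have "isCont (fourier_coeff 0 u) 0"
        using continuous_on_fourier_coeff[OF cont, of 0] by (simp add: continuous_on_eq_continuous_at)
      then show ?thesis by (rule lim)
    qed
    moreover have "(fourier_coeff 0 u \<longlongrightarrow> 2 * of_real pi * of_real (radial 0 0) * c 0) (at_right 0)"
    proof (rule Lim_transform_eventually)
      show "((\<lambda>r. 2 * of_real pi * of_real (radial 0 r) * c 0) \<longlongrightarrow> 2 * of_real pi * of_real (radial 0 0) * c 0) (at_right 0)"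
        by (intro tendsto_intros lim_real cont_radial)
      have "eventually (\<lambda>r::real. r \<in> {0<..<1}) (at_right 0)"
        by (rule eventually_at_right_real) simp
      then show "eventually (\<lambda>r. 2 * of_real pi * of_real (radial 0 r) * c 0 = fourier_coeff 0 u r) (at_right 0)"
        by eventually_elim (simp add: c)
    qed
    ultimately have "fourier_coeff 0 u 0 = 2 * of_real pi * of_real (radial 0 0) * c 0"
      by (intro tendsto_unique[OF trivial_limit_at_right_real])
    moreover have "fourier_coeff 0 u 0 = 2 * of_real pi * u 0"
      by (simp add: fourier_coeff_def scaleR_conv_of_real)
    moreover have "radial 0 0 = 1" by (simp add: radial_def)
    ultimately show ?thesis by simp
  qed
  with c bound show thesis by (rule that)
qed

text \<open>On the circle of radius \<open>|z|\<close> the series converges uniformly, so its Fourier coefficients are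
  obtained term by term and agree with those of \<open>u\<close>. The hypothesis \<open>u 0 = 0\<close> removes the
  radial mode, and the sum starts at degree \<open>1\<close>.\<close>

lemma T2_harmonic_expansion:
  assumes u: "T_harmonic 2 u" and u0: "u 0 = 0" and M: "\<And>z. cmod z < 1 \<Longrightarrow> cmod (u z) \<le> M"
  obtains a b :: "nat \<Rightarrow> complex" where
    "\<And>n. n \<ge> 1 \<Longrightarrow> cmod (a n) + cmod (b n) \<le> 2 * (real n + 1) * M / pi"
    "\<And>z. cmod z < 1 \<Longrightarrow> (\<lambda>n. mode_pair (Suc n) (a (Suc n)) (b (Suc n)) z) sums u z"
proof -
  have cont: "continuous_on (ball 0 1) u"
    using u by (auto simp: T_harmonic_def dest!: Ck_on_2_imp_1 Ck_on_1_imp_continuous_on)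
  obtain c :: "int \<Rightarrow> complex" where
    c: "\<And>k r. 0 < r \<Longrightarrow> r < 1 \<Longrightarrow> fourier_coeff k u r = 2 * of_real pi * of_real (radial (nat \<bar>k\<bar>) r) * c k"
    and cb: "\<And>n. n \<ge> 1 \<Longrightarrow> cmod (c (int n)) + cmod (c (- int n)) \<le> 2 * (real n + 1) * M / pi"
    and c0: "c 0 = 0"
    using T2_harmonic_coefficients[OF u M] u0 by metis
  define f where "f n = mode_pair (Suc n) (c (int (Suc n))) (c (- int (Suc n)))" for n
  define K where "K = 2 * M / pi"
  have f_le: "cmod (f n z) \<le> K * (real n + 2) * r ^ Suc n" if "cmod z \<le> r" "r < 1" for n z r
  proof -
    have "cmod (f n z) \<le> (cmod (c (int (Suc n))) + cmod (c (- int (Suc n)))) * r ^ Suc n"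
      unfolding f_def by (rule norm_mode_pair_le) (use that in auto)
    also have "\<dots> \<le> K * (real n + 2) * r ^ Suc n"
      using cb[of "Suc n"] that order_trans[OF norm_ge_zero that(1)]
      by (intro mult_right_mono) (auto simp: K_def field_simps)
    finally show ?thesis .
  qed
  have cont_f: "continuous_on S (f n)" for S n
    unfolding f_def mode_pair_def by (intro continuous_intros)
  have sums: "(\<lambda>n. f n z) sums u z" if z: "cmod z < 1" for z
  proof (cases "z = 0")
    case True
    then show ?thesis by (simp add: f_def mode_pair_def u0)
  next
    case False
    define r where "r = cmod z"
    have r: "0 < r" "r < 1" using z False by (auto simp: r_def)
    have summable: "summable (\<lambda>n. K * (real n + 2) * r ^ Suc n)"
      using r by (intro summable_mode_majorant) auto
    have f_circle: "cmod (f n (of_real r * w)) \<le> K * (real n + 2) * r ^ Suc n" if "cmod w = 1" for n w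
      by (rule f_le) (use that r in \<open>auto simp: norm_mult\<close>)
    have f_circle': "cmod (f n (of_real r * cis t) * cis s) \<le> K * (real n + 2) * r ^ Suc n" for n t s
      using f_circle[of "cis t" n] by (simp add: norm_mult del: power_Suc)
    define g where "g w = u (of_real r * w) - (\<Sum>n. f n (of_real r * w))" for w
    have "null_fourier g"
      unfolding null_fourier_def
    proof (intro conjI allI)
      have "uniform_limit (sphere 0 1) (\<lambda>N w. \<Sum>n<N. f n (of_real r * w)) (\<lambda>w. \<Sum>n. f n (of_real r * w)) sequentially"
        by (rule Weierstrass_m_test[OF _ summable]) (use f_circle in auto)
      then have "continuous_on (sphere 0 1) (\<lambda>w. \<Sum>n. f n (of_real r * w))"
        by (rule uniform_limit_theorem[rotated])
           (auto intro!: always_eventually continuous_on_sum continuous_on_compose2[OF cont_f] continuous_intros)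
      moreover have "continuous_on (sphere 0 1) (\<lambda>w. u (of_real r * w))"
        by (rule continuous_on_compose2[OF cont]) (use r in \<open>auto intro!: continuous_intros simp: norm_mult\<close>)
      ultimately show "continuous_on (sphere 0 1) g"
        unfolding g_def by (rule continuous_on_diff[rotated])
    next
      fix k :: int
      let ?e = "\<lambda>t. cis (- (of_int k * t))"
      have term_int: "((\<lambda>t. f n (of_real r * cis t) * ?e t) has_integral
          (if n = nat \<bar>k\<bar> - 1 then fourier_coeff k u r else 0)) {0..2*pi}" for n
      proof -
        have "((\<lambda>t. f n (of_real r * cis t) * ?e t) has_integral
            2 * of_real pi * of_real (radial (Suc n) r) * ((if int (Suc n) = k then c (int (Suc n)) else 0)
              + (if - int (Suc n) = k then c (- int (Suc n)) else 0))) {0..2*pi}"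
          unfolding f_def by (rule has_integral_mode_pair)
        also have "2 * of_real pi * of_real (radial (Suc n) r) * ((if int (Suc n) = k then c (int (Suc n)) else 0)
              + (if - int (Suc n) = k then c (- int (Suc n)) else 0))
            = (if n = nat \<bar>k\<bar> - 1 then fourier_coeff k u r else 0)"
        proof (cases "k = 0")
          case True
          then show ?thesis using c[OF r, of k] c0 by auto
        next
          case False
          show ?thesis
          proof (cases "n = nat \<bar>k\<bar> - 1")
            case True
            then have "Suc n = nat \<bar>k\<bar>" using False by simp
            moreover have "k = int (nat \<bar>k\<bar>) \<or> k = - int (nat \<bar>k\<bar>)" by linarith
            ultimately show ?thesis using c[OF r, of k] True False by auto
          qed auto
        qed
        finally show ?thesis .
      qed
      have "uniform_limit {0..2*pi} (\<lambda>N t. \<Sum>n<N. f n (of_real r * cis t) * ?e t)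
          (\<lambda>t. \<Sum>n. f n (of_real r * cis t) * ?e t) sequentially"
        by (rule Weierstrass_m_test[OF f_circle' summable])
      then obtain I J where IJ: "\<And>N. ((\<lambda>t. \<Sum>n<N. f n (of_real r * cis t) * ?e t) has_integral I N) {0..2*pi}"
          "((\<lambda>t. \<Sum>n. f n (of_real r * cis t) * ?e t) has_integral J) {0..2*pi}" "I \<longlonglongrightarrow> J"
        by (rule uniform_limit_integral)
           (auto intro!: continuous_on_sum continuous_on_mult continuous_on_compose2[OF cont_f] continuous_intros)
      have "I N = (\<Sum>n<N. if n = nat \<bar>k\<bar> - 1 then fourier_coeff k u r else 0)" for N
        by (rule has_integral_unique[OF IJ(1)]) (intro has_integral_sum term_int finite_lessThan)
      then have "I = (\<lambda>N. \<Sum>n<N. if n = nat \<bar>k\<bar> - 1 then fourier_coeff k u r else 0)" ..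
      with IJ(3) have "(\<lambda>n. if n = nat \<bar>k\<bar> - 1 then fourier_coeff k u r else 0) sums J"
        by (simp add: sums_def)
      then have J: "J = fourier_coeff k u r"
        using sums_single[of "nat \<bar>k\<bar> - 1" "\<lambda>_. fourier_coeff k u r"] sums_unique2 by blast
      have "((\<lambda>t. u (of_real r * cis t) * ?e t - (\<Sum>n. f n (of_real r * cis t) * ?e t)) has_integral
          fourier_coeff k u r - J) {0..2*pi}"
        by (intro has_integral_diff IJ(2) fourier_coeff_has_integral cont) (use r in auto)
      moreover have "(\<Sum>n. f n (of_real r * cis t) * ?e t) = (\<Sum>n. f n (of_real r * cis t)) * ?e t" for t
        by (intro suminf_mult2[symmetric] summable_comparison_test'[OF summable, of 0])
           (use f_circle in auto)
      ultimately show "((\<lambda>t. g (cis t) * ?e t) has_integral 0) {0..2*pi}"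
        unfolding g_def J by (simp add: left_diff_distrib)
    qed
    then have "g (sgn z) = 0"
      by (rule null_fourier_imp_zero) (use False in \<open>simp add: norm_sgn\<close>)
    moreover have "of_real r * sgn z = z"
      using False by (simp add: r_def sgn_eq)
    ultimately have "u z = (\<Sum>n. f n z)" by (simp add: g_def)
    moreover have "summable (\<lambda>n. f n z)"
      by (rule summable_comparison_test'[OF summable, of 0], rule f_le) (use r in \<open>auto simp: r_def\<close>)
    ultimately show ?thesis by (simp add: summable_sums)
  qed
  show thesis
    by (rule that[of "\<lambda>n. c (int n)" "\<lambda>n. c (- int n)"]) (use cb sums in \<open>auto simp: f_def\<close>)
qed

section \<open>Linear part and remainder\<close>

lemma norm_power_diff_le:
  fixes z w :: complex
  assumes "cmod z \<le> s" "cmod w \<le> s"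
  shows "cmod (z ^ Suc n - w ^ Suc n) \<le> real (Suc n) * s ^ n * cmod (z - w)"
proof (induction n)
  case (Suc n)
  have s: "0 \<le> s" using order_trans[OF norm_ge_zero assms(1)] .
  have "z ^ Suc (Suc n) - w ^ Suc (Suc n) = z * (z ^ Suc n - w ^ Suc n) + (z - w) * w ^ Suc n"
    by (simp add: algebra_simps)
  also have "cmod \<dots> \<le> s * (real (Suc n) * s ^ n * cmod (z - w)) + cmod (z - w) * s ^ Suc n"
    using Suc assms s
    by (intro norm_triangle_le add_mono) (auto simp: norm_mult norm_power simp del: power_Suc intro!: mult_mono power_mono)
  also have "\<dots> = real (Suc (Suc n)) * s ^ Suc n * cmod (z - w)"
    by (simp add: algebra_simps)
  finally show ?case .
qed simp

text \<open>Both halves of a mode come from the single function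
  \<open>p z = z^n - (n-1)/(n+1) * z^(n+1) cnj z\<close>: the mode is \<open>a p + b cnj p\<close>. So one Lipschitz
  estimate for \<open>p\<close>, monomial by monomial, suffices.\<close>

lemma mode_pair_lipschitz:
  assumes n: "n \<ge> 1" and s: "cmod z \<le> s" "cmod w \<le> s"
  shows "cmod (mode_pair n a b z - mode_pair n a b w) \<le>
    (cmod a + cmod b) * ((real n * s ^ (n - 1) + (real n - 1) / (real n + 1) * (real n + 2) * s ^ (n + 1)) * cmod (z - w))"
proof -
  \<comment> \<open>\<open>|z|\<^sup>2 z^n = z^(n+1) cnj z\<close>, so a mode is a polynomial in \<open>z\<close> and \<open>cnj z\<close>\<close>
  define \<kappa> where "\<kappa> = (real n - 1) / (real n + 1)"
  define p where "p z = z ^ n - of_real \<kappa> * (z ^ Suc n * cnj z)" for z :: complex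
  have s0: "0 \<le> s" using order_trans[OF norm_ge_zero s(1)] .
  have \<kappa>: "0 \<le> \<kappa>" using n by (simp add: \<kappa>_def)
  have mode: "mode_pair n a b z = a * p z + b * cnj (p z)" for z
  proof -
    have "complex_of_real ((cmod z)\<^sup>2) = z * cnj z" by (rule complex_norm_square)
    then have "mode_pair n a b z = (a * z ^ n + b * cnj z ^ n) * (1 - of_real \<kappa> * (z * cnj z))"
      unfolding mode_pair_def \<kappa>_def[symmetric] by simp
    then show ?thesis by (simp add: p_def algebra_simps)
  qed
  have "cmod (z ^ Suc n * cnj z - w ^ Suc n * cnj w) = cmod (z ^ Suc n * cnj (z - w) + (z ^ Suc n - w ^ Suc n) * cnj w)"
    by (simp add: algebra_simps)
  also have "\<dots> \<le> s ^ Suc n * cmod (z - w) + real (Suc n) * s ^ n * cmod (z - w) * s"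
    using norm_power_diff_le[OF s, of n] s s0
    by (intro norm_triangle_le add_mono) (auto simp: norm_mult norm_power simp del: power_Suc complex_cnj_diff intro!: mult_mono power_mono)
  also have "\<dots> = (real n + 2) * s ^ (n + 1) * cmod (z - w)" by (simp add: algebra_simps)
  finally have 2: "cmod (z ^ Suc n * cnj z - w ^ Suc n * cnj w) \<le> (real n + 2) * s ^ (n + 1) * cmod (z - w)" .
  have 1: "cmod (z ^ n - w ^ n) \<le> real n * s ^ (n - 1) * cmod (z - w)"
    using norm_power_diff_le[OF s, of "n - 1"] n by simp
  have "p z - p w = (z ^ n - w ^ n) - of_real \<kappa> * (z ^ Suc n * cnj z - w ^ Suc n * cnj w)"
    by (simp add: p_def algebra_simps)
  also have "cmod \<dots> \<le> real n * s ^ (n - 1) * cmod (z - w) + \<kappa> * ((real n + 2) * s ^ (n + 1) * cmod (z - w))"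
    using 1 2 \<kappa> by (intro order_trans[OF norm_triangle_ineq4 add_mono]) (auto simp: norm_mult simp del: power_Suc intro!: mult_left_mono)
  also have "\<dots> = (real n * s ^ (n - 1) + \<kappa> * (real n + 2) * s ^ (n + 1)) * cmod (z - w)"
    by (simp add: algebra_simps)
  finally have p_lip: "cmod (p z - p w) \<le> (real n * s ^ (n - 1) + \<kappa> * (real n + 2) * s ^ (n + 1)) * cmod (z - w)" .
  have "mode_pair n a b z - mode_pair n a b w = a * (p z - p w) + b * cnj (p z - p w)"
    by (simp add: mode algebra_simps)
  also have "cmod \<dots> \<le> cmod a * cmod (p z - p w) + cmod b * cmod (p z - p w)"
    by (rule norm_triangle_le) (simp add: norm_mult del: complex_cnj_diff)
  also have "\<dots> = (cmod a + cmod b) * cmod (p z - p w)" by (simp add: distrib_right)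
  also have "\<dots> \<le> (cmod a + cmod b) * ((real n * s ^ (n - 1) + \<kappa> * (real n + 2) * s ^ (n + 1)) * cmod (z - w))"
    using p_lip by (intro mult_left_mono) auto
  finally show ?thesis unfolding \<kappa>_def .
qed

text \<open>The terms are the sup bounds of the modes of degree \<open>n + 2\<close>, up to the factor \<open>2 M / \<pi>\<close>.\<close>

lemma sums_tail_majorant:
  fixes s :: real
  assumes "0 \<le> s" "s < 1"
  shows "(\<lambda>n. (real n + 3) * s ^ (n + 2)) sums (s\<^sup>2 * (3 - 2 * s) / (1 - s)\<^sup>2)"
proof -
  have "(\<lambda>n. s\<^sup>2 * (of_nat (Suc n) * s ^ n + 2 * s ^ n)) sums (s\<^sup>2 * (1 / (1 - s)\<^sup>2 + 2 * (1 / (1 - s))))"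
    by (intro sums_mult sums_add geometric_deriv_sums geometric_sums) (use assms in auto)
  moreover have "(\<lambda>n. s\<^sup>2 * (of_nat (Suc n) * s ^ n + 2 * s ^ n)) = (\<lambda>n. (real n + 3) * s ^ (n + 2))"
    by (simp add: fun_eq_iff algebra_simps power2_eq_square)
  moreover have "s\<^sup>2 * (1 / w\<^sup>2 + 2 * (1 / w)) = s\<^sup>2 * (1 + 2 * w) / w\<^sup>2" if "w \<noteq> 0" for w :: real
    using that by (simp add: divide_simps power2_eq_square distrib_left)
  from this[of "1 - s"] have "s\<^sup>2 * (1 / (1 - s)\<^sup>2 + 2 * (1 / (1 - s))) = s\<^sup>2 * (3 - 2 * s) / (1 - s)\<^sup>2"
    using assms by simp
  with calculation show ?thesis by simp
qed

text \<open>The terms are the Lipschitz bounds of the modes of degree \<open>n + 2\<close>, up to the factor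
  \<open>2 M / \<pi>\<close>; their sum is the rational function in the equation for \<open>r\<^sub>0\<close>.\<close>

lemma sums_lipschitz_majorant:
  fixes s :: real
  assumes "0 \<le> s" "s < 1"
  shows "(\<lambda>n. (real n + 2) * (real n + 3) * s ^ (n + 1) + (real n + 1) * (real n + 4) * s ^ (n + 3)) sums
     (2 * (s / (1 - s) ^ 3) * (- (s ^ 3) + 3 * s ^ 2 - 3 * s + 3))"
proof -
  have ns: "norm s < 1" using assms by simp
  have s2: "(\<lambda>n. real ((n + 1) * (n + 2)) * s ^ n) sums (2 / (1 - s) ^ 3)"
  proof -
    have "((\<lambda>z. 1 / (1 - z)\<^sup>2) has_field_derivative 2 / (1 - s) ^ 3) (at s)"
    proof (rule derivative_eq_intros refl | simp add: assms)+
      have "(0 * w\<^sup>2 - 1 * (real 2 * ((0 - 1) * w ^ (2 - Suc 0)))) / (w\<^sup>2 * w\<^sup>2) = 2 / w ^ 3" if "w \<noteq> 0" for w :: real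
        using that by (simp add: field_simps power2_eq_square power3_eq_cube)
      from this[of "1 - s"] show "(0 * (1 - s)\<^sup>2 - 1 * (real 2 * ((0 - 1) * (1 - s) ^ (2 - Suc 0)))) / ((1 - s)\<^sup>2 * (1 - s)\<^sup>2) = 2 / (1 - s) ^ 3"
        using assms by simp
    qed (use assms in auto)
    from termdiffs_sums_strong[OF geometric_deriv_sums this ns]
    have "(\<lambda>n. diffs (\<lambda>n. of_nat (Suc n)) n * s ^ n) sums (2 / (1 - s) ^ 3)" .
    moreover have "diffs (\<lambda>n. of_nat (Suc n)) n = real ((n + 1) * (n + 2))" for n
      by (simp add: diffs_def algebra_simps)
    ultimately show ?thesis by simp
  qed
  have "(\<lambda>n. s * ((real ((n + 1) * (n + 2)) * s ^ n + 2 * (of_nat (Suc n) * s ^ n)) + 2 * s ^ n)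
      + s ^ 3 * (real ((n + 1) * (n + 2)) * s ^ n + 2 * (of_nat (Suc n) * s ^ n))) sums
    (s * ((2 / (1 - s) ^ 3 + 2 * (1 / (1 - s)\<^sup>2)) + 2 * (1 / (1 - s))) + s ^ 3 * (2 / (1 - s) ^ 3 + 2 * (1 / (1 - s)\<^sup>2)))"
    by (intro sums_mult sums_add s2 geometric_deriv_sums[OF ns] geometric_sums ns)
  moreover have "(\<lambda>n. s * ((real ((n + 1) * (n + 2)) * s ^ n + 2 * (of_nat (Suc n) * s ^ n)) + 2 * s ^ n)
      + s ^ 3 * (real ((n + 1) * (n + 2)) * s ^ n + 2 * (of_nat (Suc n) * s ^ n)))
    = (\<lambda>n. (real n + 2) * (real n + 3) * s ^ (n + 1) + (real n + 1) * (real n + 4) * s ^ (n + 3))"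
    by (simp add: fun_eq_iff algebra_simps power_add power3_eq_cube)
  moreover have "s * ((2 / (1 - s) ^ 3 + 2 * (1 / (1 - s)\<^sup>2)) + 2 * (1 / (1 - s))) + s ^ 3 * (2 / (1 - s) ^ 3 + 2 * (1 / (1 - s)\<^sup>2))
     = 2 * (s / (1 - s) ^ 3) * (- (s ^ 3) + 3 * s ^ 2 - 3 * s + 3)"
  proof -
    have "s * ((2 / w ^ 3 + 2 * (1 / w\<^sup>2)) + 2 * (1 / w)) + s ^ 3 * (2 / w ^ 3 + 2 * (1 / w\<^sup>2))
       = 2 * (s / w ^ 3) * (1 + w + w\<^sup>2 + s\<^sup>2 * (1 + w))" if "w \<noteq> 0" for w
      using that by (simp add: divide_simps) (simp add: eval_nat_numeral algebra_simps)
    moreover have "1 + (1 - s) + (1 - s)\<^sup>2 + s\<^sup>2 * (1 + (1 - s)) = - (s ^ 3) + 3 * s ^ 2 - 3 * s + 3"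
      by (simp add: power2_eq_square power3_eq_cube algebra_simps)
    ultimately show ?thesis using assms(2) by (metis diff_gt_0_iff_gt less_irrefl)
  qed
  ultimately show ?thesis by simp
qed

text \<open>The mode of degree \<open>1\<close> has radial factor \<open>1\<close>, so it is exactly the real linear part of \<open>u\<close>; all
  modes of higher degree go into the remainder.\<close>

lemma T2_harmonic_decomposition:
  assumes u: "T_harmonic 2 u" and u0: "u 0 = 0" and M: "\<And>z. cmod z < 1 \<Longrightarrow> cmod (u z) \<le> M"
  obtains a b R where
    "\<And>z. cmod z < 1 \<Longrightarrow> u z = a * z + b * cnj z + R z"
    "cmod a + cmod b \<le> 4 * M / pi"
    "\<And>z s. cmod z \<le> s \<Longrightarrow> s < 1 \<Longrightarrow> cmod (R z) \<le> 2 * M / pi * (s\<^sup>2 * (3 - 2 * s) / (1 - s)\<^sup>2)"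
    "\<And>z w s. cmod z \<le> s \<Longrightarrow> cmod w \<le> s \<Longrightarrow> s < 1 \<Longrightarrow>
       cmod (R z - R w) \<le> 4 / pi * (M * s / (1 - s) ^ 3) * (- (s ^ 3) + 3 * s ^ 2 - 3 * s + 3) * cmod (z - w)"
proof -
  obtain a b where ab: "\<And>n. n \<ge> 1 \<Longrightarrow> cmod (a n) + cmod (b n) \<le> 2 * (real n + 1) * M / pi"
    and sums: "\<And>z. cmod z < 1 \<Longrightarrow> (\<lambda>n. mode_pair (Suc n) (a (Suc n)) (b (Suc n)) z) sums u z"
    by (rule T2_harmonic_expansion[OF u u0 M]) auto
  define f where "f n = mode_pair (n + 2) (a (n + 2)) (b (n + 2))" for n
  define R where "R z = (\<Sum>n. f n z)" for z
  define K where "K = 2 * M / pi"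
  have K: "cmod (a (n + 2)) + cmod (b (n + 2)) \<le> K * (real n + 3)" for n
    using ab[of "n + 2"] by (simp add: K_def field_simps)
  have f_sums: "(\<lambda>n. f n z) sums (u z - (a 1 * z + b 1 * cnj z))" if "cmod z < 1" for z
  proof -
    have "(\<lambda>n. mode_pair (Suc (Suc n)) (a (Suc (Suc n))) (b (Suc (Suc n))) z) sums (u z - mode_pair 1 (a 1) (b 1) z)"
      using sums_split_initial_segment[OF sums[OF that], of 1] by simp
    then show ?thesis by (simp add: f_def mode_pair_def)
  qed
  show thesis
  proof
    show "u z = a 1 * z + b 1 * cnj z + R z" if "cmod z < 1" for z
      using f_sums[OF that] by (simp add: R_def sums_iff)
    show "cmod (a 1) + cmod (b 1) \<le> 4 * M / pi"
      using ab[of 1] by simp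
  next
    fix z s assume s: "cmod z \<le> s" "s < 1"
    have s0: "0 \<le> s" using order_trans[OF norm_ge_zero s(1)] .
    show "cmod (R z) \<le> 2 * M / pi * (s\<^sup>2 * (3 - 2 * s) / (1 - s)\<^sup>2)"
      unfolding R_def K_def[symmetric]
    proof (rule norm_sums_le[OF summable_sums])
      show "summable (\<lambda>n. f n z)" using f_sums[of z] s by (simp add: sums_iff)
      show "(\<lambda>n. K * ((real n + 3) * s ^ (n + 2))) sums (K * (s\<^sup>2 * (3 - 2 * s) / (1 - s)\<^sup>2))"
        by (intro sums_mult sums_tail_majorant s0 s)
      show "cmod (f n z) \<le> K * ((real n + 3) * s ^ (n + 2))" for n
      proof -
        have "cmod (f n z) \<le> (cmod (a (n + 2)) + cmod (b (n + 2))) * s ^ (n + 2)"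
          unfolding f_def by (rule norm_mode_pair_le) (use s in auto)
        also have "\<dots> \<le> K * (real n + 3) * s ^ (n + 2)" by (intro mult_right_mono K) (use s0 in auto)
        finally show ?thesis by (simp add: mult.assoc)
      qed
    qed
  next
    fix z w s assume s: "cmod z \<le> s" "cmod w \<le> s" "s < 1"
    have s0: "0 \<le> s" using order_trans[OF norm_ge_zero s(1)] .
    let ?L = "\<lambda>n. (real n + 2) * (real n + 3) * s ^ (n + 1) + (real n + 1) * (real n + 4) * s ^ (n + 3)"
    have R_diff: "R z - R w = (\<Sum>n. f n z - f n w)"
      unfolding R_def using f_sums[of z] f_sums[of w] s by (intro suminf_diff) (auto simp: sums_iff)
    have "cmod (R z - R w) \<le> K * (2 * (s / (1 - s) ^ 3) * (- (s ^ 3) + 3 * s ^ 2 - 3 * s + 3)) * cmod (z - w)"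
      unfolding R_diff
    proof (rule norm_sums_le[OF summable_sums])
      show "summable (\<lambda>n. f n z - f n w)"
        using f_sums[of z] f_sums[of w] s by (intro summable_diff) (auto simp: sums_iff)
      show "(\<lambda>n. K * ?L n * cmod (z - w)) sums (K * (2 * (s / (1 - s) ^ 3) * (- (s ^ 3) + 3 * s ^ 2 - 3 * s + 3)) * cmod (z - w))"
        by (intro sums_mult sums_mult2 sums_lipschitz_majorant s0 s)
      show "cmod (f n z - f n w) \<le> K * ?L n * cmod (z - w)" for n
      proof -
        let ?l = "real (n + 2) * s ^ (n + 2 - 1) + (real (n + 2) - 1) / (real (n + 2) + 1) * (real (n + 2) + 2) * s ^ (n + 2 + 1)"
        have "cmod (f n z - f n w) \<le> (cmod (a (n + 2)) + cmod (b (n + 2))) * (?l * cmod (z - w))"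
          unfolding f_def by (rule mode_pair_lipschitz) (use s in auto)
        also have "\<dots> \<le> K * (real n + 3) * (?l * cmod (z - w))"
          by (intro mult_right_mono K mult_nonneg_nonneg add_nonneg_nonneg) (use s0 in auto)
        also have "\<dots> = K * ((real n + 3) * ?l) * cmod (z - w)" by (simp only: mult.assoc)
        also have "(real n + 3) * ?l = ?L n"
        proof -
          have "(x + 3) * ((x + 2) * P + (x + 1) / (x + 3) * (x + 4) * Q) = (x + 2) * (x + 3) * P + (x + 1) * (x + 4) * Q"
            if "x \<ge> 0" for x P Q :: real
            using that by (simp add: field_simps)
          moreover have "n + 2 - 1 = n + 1" "n + 2 + 1 = n + 3" "real (n + 2) = real n + 2" "real n + 2 - 1 = real n + 1"
            "real n + 2 + 1 = real n + 3" "real n + 2 + 2 = real n + 4" by simp_all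
          ultimately show ?thesis by (simp only: of_nat_0_le_iff)
        qed
        finally show ?thesis .
      qed
    qed
    also have "K * (2 * (s / (1 - s) ^ 3) * (- (s ^ 3) + 3 * s ^ 2 - 3 * s + 3)) = 4 / pi * (M * s / (1 - s) ^ 3) * (- (s ^ 3) + 3 * s ^ 2 - 3 * s + 3)"
      by (simp add: K_def)
    finally show "cmod (R z - R w) \<le> 4 / pi * (M * s / (1 - s) ^ 3) * (- (s ^ 3) + 3 * s ^ 2 - 3 * s + 3) * cmod (z - w)" .
  qed
qed

text \<open>The number \<open>||a| - |b||\<close> is the smallest singular value of the real linear map
  \<open>h \<mapsto> a h + b cnj h\<close>.\<close>

lemma norm_real_linear_ge:
  "cmod (a * h + b * cnj h) \<ge> \<bar>cmod a - cmod b\<bar> * cmod h"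
proof -
  have "\<bar>cmod (a * h) - cmod (- (b * cnj h))\<bar> \<le> cmod (a * h - - (b * cnj h))"
    by (rule norm_triangle_ineq3)
  then show ?thesis by (simp add: norm_mult abs_mult flip: left_diff_distrib)
qed

lemma Jac_of_real_linear_derivative:
  assumes "(u has_derivative (\<lambda>h. a * h + b * cnj h)) (at z)"
  shows "Jac u z = (cmod a)\<^sup>2 - (cmod b)\<^sup>2"
proof -
  have "wirtinger u z = a" "wirtinger_bar u z = b"
    by (simp_all add: wirtinger_def wirtinger_bar_def partials_of_has_derivative[OF assms] algebra_simps)
  then show ?thesis by (simp add: Jac_def)
qed

lemma has_derivative_quadratic_remainder:
  fixes u :: "complex \<Rightarrow> complex"
  assumes "d > 0" and u: "\<And>z. cmod z < d \<Longrightarrow> u z = a * z + b * cnj z + R z"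
    and R: "\<And>z. cmod z < d \<Longrightarrow> cmod (R z) \<le> C * (cmod z)\<^sup>2"
  shows "(u has_derivative (\<lambda>h. a * h + b * cnj h)) (at 0)"
  unfolding has_derivative_iff_norm
proof
  show "bounded_linear (\<lambda>h. a * h + b * cnj h)"
    by (intro bounded_linear_add bounded_linear_mult_right bounded_linear_compose[OF bounded_linear_mult_right bounded_linear_cnj])
  have ev: "eventually (\<lambda>y. cmod y < d) (at 0)"
    unfolding eventually_at using \<open>d > 0\<close> by (auto simp: dist_norm)
  have u0: "u 0 = 0" using u[of 0] R[of 0] \<open>d > 0\<close> by simp
  show "((\<lambda>y. norm (u y - u 0 - (a * (y - 0) + b * cnj (y - 0))) / norm (y - 0)) \<longlongrightarrow> 0) (at 0)"
  proof (rule tendsto_sandwich[where f = "\<lambda>_. 0"])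
    show "((\<lambda>y. C * cmod y) \<longlongrightarrow> 0) (at 0)" by (auto intro!: tendsto_eq_intros)
    show "eventually (\<lambda>y. norm (u y - u 0 - (a * (y - 0) + b * cnj (y - 0))) / norm (y - 0) \<le> C * cmod y) (at 0)"
      using ev
    proof eventually_elim
      case (elim y)
      then show ?case using R[OF elim] u[OF elim] u0
        by (cases "y = 0") (auto simp: field_simps power2_eq_square)
    qed
  qed (auto intro: always_eventually)
qed

section \<open>Disks in the image\<close>

text \<open>By invariance of domain the image \<open>D\<close> of a disk of radius \<open>s < r0\<close> is open, and its frontier
  lies in the image of the circle of radius \<open>s\<close>. If all points of that circle are mapped further
  out than \<open>|w|\<close>, the closed disk of radius \<open>|w|\<close> meets \<open>D\<close> at \<open>0\<close> but not its frontier, so it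
  lies in \<open>D\<close>. The inverse of \<open>f\<close> is continuous, which makes the preimage of the disk connected.\<close>

lemma univalent_disk_of_boundary_bound:
  assumes cont: "continuous_on (ball 0 r0) f" and inj: "inj_on f (ball 0 r0)" and f0: "f 0 = 0"
    and "R > 0"
    and bd: "\<And>\<rho>. 0 \<le> \<rho> \<Longrightarrow> \<rho> < R \<Longrightarrow> \<exists>s. 0 < s \<and> s < r0 \<and> (\<forall>z. cmod z = s \<longrightarrow> \<rho> < cmod (f z))"
  shows "univalent_disk f (ball 0 r0) 0 R"
proof -
  have sub: "ball 0 R \<subseteq> f ` ball 0 r0"
  proof
    fix w assume "w \<in> ball (0::complex) R"
    then have "cmod w < R" by simp
    then obtain s where s: "0 < s" "s < r0" "\<And>z. cmod z = s \<Longrightarrow> cmod w < cmod (f z)"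
      using bd[of "cmod w"] by auto
    let ?D = "f ` ball 0 s" and ?T = "cball (0::complex) (cmod w)"
    have op: "open ?D"
      by (rule invariance_of_domain) (use s in \<open>auto intro: continuous_on_subset[OF cont] inj_on_subset[OF inj]\<close>)
    have "compact (f ` cball 0 s)"
      by (rule compact_continuous_image) (use s in \<open>auto intro: continuous_on_subset[OF cont]\<close>)
    then have "closure ?D \<subseteq> f ` cball 0 s"
      by (intro closure_minimal image_mono ball_subset_cball compact_imp_closed)
    then have "frontier ?D \<subseteq> f ` sphere 0 s"
      using op by (auto simp: frontier_def interior_open) (smt (verit) image_iff mem_ball_0 mem_cball_0 mem_sphere_0 subsetD)
    then have "?T \<inter> frontier ?D = {}" using s(3) by fastforce
    moreover have "0 \<in> ?D" using f0 s(1) by (metis centre_in_ball image_eqI)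
    then have "?T \<inter> ?D \<noteq> {}" by (metis IntI empty_iff mem_cball_0 norm_ge_zero norm_zero)
    ultimately have "?T - ?D = {}"
      using connected_Int_frontier[of ?T ?D] by auto
    then have "w \<in> ?D" by auto
    then show "w \<in> f ` ball 0 r0" using s(2) by auto
  qed
  obtain g where g: "homeomorphism (ball 0 r0) (f ` ball 0 r0) f g"
    using invariance_of_domain_homeomorphism[OF open_ball cont _ inj] by auto
  define U where "U = g ` ball 0 R"
  have gf: "\<And>x. x \<in> ball 0 r0 \<Longrightarrow> g (f x) = x" and fg: "\<And>y. y \<in> f ` ball 0 r0 \<Longrightarrow> f (g y) = y"
    and gcont: "continuous_on (f ` ball 0 r0) g" and gim: "g ` f ` ball 0 r0 = ball 0 r0"
    using g by (auto simp: homeomorphism_def)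
  have U: "U \<subseteq> ball 0 r0" using gim sub unfolding U_def by blast
  have "U = ball 0 r0 \<inter> f -` ball 0 R"
    using U sub gf fg unfolding U_def by (auto simp: image_iff) (metis dist_0_norm gf image_eqI mem_ball)
  then have "open U" using continuous_open_preimage[OF cont open_ball open_ball] by simp
  moreover have "connected U"
    unfolding U_def by (intro connected_continuous_image continuous_on_subset[OF gcont sub] connected_ball)
  moreover have "f ` U = ball 0 R"
    unfolding U_def image_image using fg sub by (force simp: image_iff)
  moreover have "U \<noteq> {}" using \<open>R > 0\<close> by (simp add: U_def)
  ultimately show ?thesis
    unfolding univalent_disk_def using \<open>R > 0\<close> sub U inj_on_subset[OF inj U] by blast
qed

section \<open>Univalence radius\<close>

text \<open>In terms of \<open>t = 1 / (1 - x)\<close> the expression is \<open>t\<^sup>3 - 1 + x\<^sup>2 t (t\<^sup>2 - 1)\<close>, in which every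
  factor visibly increases with \<open>x\<close>.\<close>

lemma lipschitz_majorant_strict_mono:
  fixes s r :: real
  assumes "0 \<le> s" "s < r" "r < 1"
  shows "s / (1 - s) ^ 3 * (- (s ^ 3) + 3 * s ^ 2 - 3 * s + 3) < r / (1 - r) ^ 3 * (- (r ^ 3) + 3 * r ^ 2 - 3 * r + 3)"
proof -
  define g where "g t x = t ^ 3 - 1 + x\<^sup>2 * (t * (t\<^sup>2 - 1))" for t x :: real
  have eq: "x / (1 - x) ^ 3 * (- (x ^ 3) + 3 * x ^ 2 - 3 * x + 3) = g (1 / (1 - x)) x" if "x < 1" for x :: real
    using that by (simp add: g_def divide_simps) (simp add: eval_nat_numeral algebra_simps)
  define t T where "t = 1 / (1 - s)" "T = 1 / (1 - r)"
  have tT: "1 \<le> t" "t < T" using assms by (auto simp: t_T_def field_simps)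
  have "t ^ 3 < T ^ 3" using tT by (intro power_strict_mono) auto
  moreover have "s\<^sup>2 * (t * (t\<^sup>2 - 1)) \<le> r\<^sup>2 * (T * (T\<^sup>2 - 1))"
    using assms tT by (intro mult_mono power_mono diff_right_mono) (auto simp: one_le_power)
  ultimately have "g t s < g T r" by (simp add: g_def)
  then show ?thesis using eq[of s] eq[of r] assms by (simp add: t_T_def)
qed

text \<open>Multiplied by \<open>(1 - r)\<^sup>3\<close> the equation is polynomial, so the intermediate value theorem
  applies on the closed interval \<open>[0,1]\<close>.\<close>

lemma exists_radius:
  fixes M :: real
  assumes "M > 0"
  shows "\<exists>r0::real. 0 < r0 \<and> r0 < 1 \<and>
        pi / (4 * M) - 4 / pi * (M * r0 / (1 - r0) ^ 3) * (- (r0 ^ 3) + 3 * r0 ^ 2 - 3 * r0 + 3) = 0"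
proof -
  define p where "p r = pi / (4 * M) * (1 - r) ^ 3 - 4 / pi * (M * r) * (- (r ^ 3) + 3 * r ^ 2 - 3 * r + 3)" for r :: real
  have "\<exists>r. 0 \<le> r \<and> r \<le> 1 \<and> p r = 0"
  proof (rule IVT2')
    show "continuous_on {0..1} p" unfolding p_def by (intro continuous_intros)
  qed (use assms in \<open>auto simp: p_def\<close>)
  then obtain r where r: "0 \<le> r" "r \<le> 1" "p r = 0" by blast
  have "p 0 > 0" "p 1 < 0" using assms by (auto simp: p_def)
  with r have r': "0 < r" "r < 1" by (auto simp: order_less_le)
  have "pi / (4 * M) - 4 / pi * (M * r / (1 - r) ^ 3) * (- (r ^ 3) + 3 * r ^ 2 - 3 * r + 3) = p r / (1 - r) ^ 3"
    using r' by (simp add: p_def diff_divide_distrib)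
  then show ?thesis using r r' by auto
qed

text \<open>The right-hand side is the lower bound for \<open>|u|\<close> on the circle of radius \<open>r\<close>, with
  \<open>\<pi>/(4M)\<close> replaced by the expression that equals it at \<open>r = r\<^sub>0\<close>. The difference of the two sides
  is \<open>2 M r\<^sup>2 / (\<pi> (1 - r)\<^sup>3) * (3 r - r\<^sup>2/2 - 2 r\<^sup>3/5)\<close>; being positive, it leaves room to
  pass from \<open>r\<^sub>0\<close> to a slightly smaller radius.\<close>

lemma boundary_bound_exceeds_radius:
  fixes M r :: real
  assumes "M > 0" "0 < r" "r < 1"
  shows "4 * M * r ^ 2 / (pi * (1 - r) ^ 3) * (- (4 / 5 * r ^ 3) + 9 / 4 * r ^ 2 - 2 * r + 3 / 2)
     < 4 / pi * (M * r / (1 - r) ^ 3) * (- (r ^ 3) + 3 * r ^ 2 - 3 * r + 3) * r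
        - 2 * M / pi * (r\<^sup>2 * (3 - 2 * r) / (1 - r)\<^sup>2)" (is "?R < ?m")
proof -
  have "r\<^sup>2 < 1" using assms by (simp add: power_less_one_iff)
  moreover have "r ^ 3 = r * r\<^sup>2" by (simp add: power2_eq_square power3_eq_cube)
  moreover have "r * r\<^sup>2 \<le> r * 1" "r\<^sup>2 \<le> r" using assms \<open>r\<^sup>2 < 1\<close> by (auto simp: power2_eq_square mult_left_le)
  ultimately have pos: "3 * r - r\<^sup>2 / 2 - 2 / 5 * r ^ 3 > 0" using assms by linarith
  have "?m - ?R = 2 * M * r\<^sup>2 / (pi * (1 - r) ^ 3) * (3 * r - r\<^sup>2 / 2 - 2 / 5 * r ^ 3)"
  proof -
    have "4 / pi * (M * r / w ^ 3) * A * r - 2 * M / pi * (r\<^sup>2 * B / w\<^sup>2) - 4 * M * r ^ 2 / (pi * w ^ 3) * C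
       = 2 * M * r\<^sup>2 / (pi * w ^ 3) * (2 * A - B * w - 2 * C)" if "w \<noteq> 0" for w A B C :: real
      using that by (simp add: field_simps power2_eq_square power3_eq_cube)
    moreover have "2 * (- (r ^ 3) + 3 * r ^ 2 - 3 * r + 3) - (3 - 2 * r) * (1 - r)
       - 2 * (- (4 / 5 * r ^ 3) + 9 / 4 * r ^ 2 - 2 * r + 3 / 2) = 3 * r - r\<^sup>2 / 2 - 2 / 5 * r ^ 3"
      by (simp add: algebra_simps power2_eq_square)
    ultimately show ?thesis using assms by simp
  qed
  also have "\<dots> > 0" using assms pos by simp
  finally show ?thesis by simp
qed

text \<open>The quadratic part of the bracket is at least \<open>3/2 - 4/9\<close>, by completing the square, which is
  larger than the \<open>4/5\<close> that the cubic term can take away.\<close>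

lemma radius_pos:
  fixes M r :: real
  assumes "M > 0" "0 < r" "r < 1"
  shows "4 * M * r ^ 2 / (pi * (1 - r) ^ 3) * (- (4 / 5 * r ^ 3) + 9 / 4 * r ^ 2 - 2 * r + 3 / 2) > 0"
proof -
  have "r ^ 3 < 1" using assms by (simp add: power_less_one_iff)
  moreover have "0 \<le> (3 / 2 * r - 2 / 3)\<^sup>2" by simp
  then have "0 \<le> 9 / 4 * r\<^sup>2 - 2 * r + 4 / 9" by (simp add: power2_eq_square algebra_simps)
  ultimately have "- (4 / 5 * r ^ 3) + 9 / 4 * r ^ 2 - 2 * r + 3 / 2 > 0" by linarith
  then show ?thesis using assms by simp
qed

theorem theorem3:
  fixes u :: "complex \<Rightarrow> complex" and M :: real
  assumes "T_harmonic 2 u"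
    and "u 0 = 0"
    and "\<bar>Jac u 0\<bar> - 1 = 0"
    and "M > 0"
    and "\<forall>z\<in>ball 0 1. cmod (u z) \<le> M"
  shows
    "(\<exists>r0::real. 0 < r0 \<and> r0 < 1 \<and>
        pi / (4 * M) - 4 / pi * (M * r0 / (1 - r0) ^ 3) * (- (r0 ^ 3) + 3 * r0 ^ 2 - 3 * r0 + 3) = 0) \<and>
     (\<forall>r0::real. 0 < r0 \<and> r0 < 1 \<and>
        pi / (4 * M) - 4 / pi * (M * r0 / (1 - r0) ^ 3) * (- (r0 ^ 3) + 3 * r0 ^ 2 - 3 * r0 + 3) = 0
        \<longrightarrow>
        inj_on u (ball 0 r0) \<and>
        (\<exists>R0. R0 \<ge> 4 * M * r0 ^ 2 / (pi * (1 - r0) ^ 3) *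
                 (- (4 / 5 * r0 ^ 3) + 9 / 4 * r0 ^ 2 - 2 * r0 + 3 / 2) \<and>
              univalent_disk u (ball 0 r0) 0 R0))"
proof (intro conjI allI impI)
  show "\<exists>r0::real. 0 < r0 \<and> r0 < 1 \<and>
        pi / (4 * M) - 4 / pi * (M * r0 / (1 - r0) ^ 3) * (- (r0 ^ 3) + 3 * r0 ^ 2 - 3 * r0 + 3) = 0"
    by (rule exists_radius) fact
next
  \<comment> \<open>Lipschitz constant and sup bound of the part of \<open>u\<close> of degree at least \<open>2\<close> on the disk of radius \<open>s\<close>\<close>
  define lip where "lip s = 4 / pi * (M * s / (1 - s) ^ 3) * (- (s ^ 3) + 3 * s ^ 2 - 3 * s + 3)" for s
  define tail where "tail s = 2 * M / pi * (s\<^sup>2 * (3 - 2 * s) / (1 - s)\<^sup>2)" for s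
  have M: "cmod (u z) \<le> M" if "cmod z < 1" for z using assms(5) that by simp
  obtain a b R where u: "\<And>z. cmod z < 1 \<Longrightarrow> u z = a * z + b * cnj z + R z"
    and ab: "cmod a + cmod b \<le> 4 * M / pi"
    and R_le: "\<And>z s. cmod z \<le> s \<Longrightarrow> s < 1 \<Longrightarrow> cmod (R z) \<le> tail s"
    and R_lip: "\<And>z w s. cmod z \<le> s \<Longrightarrow> cmod w \<le> s \<Longrightarrow> s < 1 \<Longrightarrow> cmod (R z - R w) \<le> lip s * cmod (z - w)"
    unfolding lip_def tail_def by (rule T2_harmonic_decomposition[OF assms(1,2) M]) auto
  have "(u has_derivative (\<lambda>h. a * h + b * cnj h)) (at 0)"
  proof (rule has_derivative_quadratic_remainder[of "1/2" u a b R])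
    fix z :: complex assume z: "cmod z < 1/2"
    have "cmod (R z) \<le> tail (cmod z)" using z by (intro R_le) auto
    also have "\<dots> \<le> 2 * M / pi * ((cmod z)\<^sup>2 * 3 / (1/2)\<^sup>2)"
      unfolding tail_def using z assms(4)
      by (intro mult_left_mono frac_le mult_left_mono power_mono) auto
    finally show "cmod (R z) \<le> (24 * M / pi) * (cmod z)\<^sup>2" by (simp add: power2_eq_square)
  qed (use u in auto)
  then have "\<bar>(cmod a)\<^sup>2 - (cmod b)\<^sup>2\<bar> = 1"
    using assms(3) by (simp add: Jac_of_real_linear_derivative)
  \<comment> \<open>the two factors are the smallest and the largest singular value of the derivative at \<open>0\<close>\<close>
  then have J: "\<bar>cmod a - cmod b\<bar> * (cmod a + cmod b) = 1"
    by (simp add: power2_eq_square square_diff_square_factored abs_mult mult.commute)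
  have "1 \<le> \<bar>cmod a - cmod b\<bar> * (4 * M / pi)"
    unfolding J[symmetric] by (intro mult_left_mono ab) auto
  then have "pi / (4 * M) \<le> \<bar>cmod a - cmod b\<bar>"
    using assms(4) by (simp add: field_simps)
  then have linear_ge: "pi / (4 * M) * cmod h \<le> cmod (a * h + b * cnj h)" for h
    by (intro order_trans[OF mult_right_mono norm_real_linear_ge]) auto

  fix r0 :: real
  assume "0 < r0 \<and> r0 < 1 \<and>
        pi / (4 * M) - 4 / pi * (M * r0 / (1 - r0) ^ 3) * (- (r0 ^ 3) + 3 * r0 ^ 2 - 3 * r0 + 3) = 0"
  then have r0: "0 < r0" "r0 < 1" and lip_r0: "pi / (4 * M) = lip r0"
    by (auto simp: lip_def)
  show inj: "inj_on u (ball 0 r0)"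
  proof (rule inj_onI, rule ccontr)
    fix z w assume zw: "z \<in> ball 0 r0" "w \<in> ball 0 r0" and eq: "u z = u w" and "z \<noteq> w"
    \<comment> \<open>both points lie in a closed disk of radius \<open>s < r0\<close>, where the Lipschitz constant is still below \<open>lip r0\<close>\<close>
    define s where "s = max (cmod z) (cmod w)"
    have s: "cmod z \<le> s" "cmod w \<le> s" "0 \<le> s" "s < r0" using zw by (auto simp: s_def le_max_iff_disj)
    have "s / (1 - s) ^ 3 * (- (s ^ 3) + 3 * s ^ 2 - 3 * s + 3) < r0 / (1 - r0) ^ 3 * (- (r0 ^ 3) + 3 * r0 ^ 2 - 3 * r0 + 3)"
      by (rule lipschitz_majorant_strict_mono) (use s r0 in auto)
    then have "4 * M / pi * (s / (1 - s) ^ 3 * (- (s ^ 3) + 3 * s ^ 2 - 3 * s + 3))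
       < 4 * M / pi * (r0 / (1 - r0) ^ 3 * (- (r0 ^ 3) + 3 * r0 ^ 2 - 3 * r0 + 3))"
      using assms(4) by (intro mult_strict_left_mono) auto
    then have "lip s < lip r0" by (simp add: lip_def mult_ac)
    have "0 = (a * (z - w) + b * cnj (z - w)) + (R z - R w)"
      using eq u[of z] u[of w] zw r0 by (simp add: algebra_simps)
    then have "cmod (a * (z - w) + b * cnj (z - w)) = cmod (R z - R w)"
      by (metis add_eq_0_iff norm_minus_cancel)
    also have "\<dots> \<le> lip s * cmod (z - w)" using s r0 by (intro R_lip) auto
    also have "\<dots> < lip r0 * cmod (z - w)" using \<open>lip s < lip r0\<close> \<open>z \<noteq> w\<close> by simp
    also have "\<dots> \<le> cmod (a * (z - w) + b * cnj (z - w))" using linear_ge[of "z - w"] lip_r0 by simp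
    finally show False by simp
  qed
  define R0 where "R0 = 4 * M * r0 ^ 2 / (pi * (1 - r0) ^ 3) *
                 (- (4 / 5 * r0 ^ 3) + 9 / 4 * r0 ^ 2 - 2 * r0 + 3 / 2)"
  have "univalent_disk u (ball 0 r0) 0 R0"
  proof (rule univalent_disk_of_boundary_bound[OF _ inj assms(2)])
    have "continuous_on (ball 0 1) u"
      using assms(1) by (auto simp: T_harmonic_def dest!: Ck_on_2_imp_1 Ck_on_1_imp_continuous_on)
    then show "continuous_on (ball 0 r0) u"
      by (rule continuous_on_subset) (use r0 in auto)
    show "R0 > 0" unfolding R0_def by (rule radius_pos) (use assms r0 in auto)
  next
    fix \<rho> :: real assume \<rho>: "\<rho> < R0"
    have "R0 < lip r0 * r0 - tail r0"
      unfolding R0_def lip_def tail_def by (rule boundary_bound_exceeds_radius) (use assms r0 in auto)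
    \<comment> \<open>the circle of radius \<open>r0\<close> itself bounds the domain of injectivity, so a smaller circle is chosen by continuity\<close>
    moreover have "isCont (\<lambda>s. lip r0 * s - tail s) r0"
      unfolding tail_def using r0 by (intro continuous_intros) auto
    then have "((\<lambda>s. lip r0 * s - tail s) \<longlongrightarrow> lip r0 * r0 - tail r0) (at_left r0)"
      using continuous_at_imp_continuous_at_within by (auto simp: continuous_within)
    ultimately have "eventually (\<lambda>s. \<rho> < lip r0 * s - tail s) (at_left r0)"
      using \<rho> by (metis order_tendstoD(1) order.strict_trans)
    moreover have "eventually (\<lambda>s. s \<in> {0<..<r0}) (at_left r0)"
      using r0 by (intro eventually_at_left_real)
    ultimately have "eventually (\<lambda>s. \<rho> < lip r0 * s - tail s \<and> s \<in> {0<..<r0}) (at_left r0)"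
      by (rule eventually_conj)
    then obtain s where s: "\<rho> < lip r0 * s - tail s" "0 < s" "s < r0"
      by (auto dest: eventually_happens)
    have "\<rho> < cmod (u z)" if z: "cmod z = s" for z
    proof -
      have "lip r0 * s - tail s \<le> cmod (a * z + b * cnj z) - cmod (- R z)"
        using linear_ge[of z] lip_r0 R_le[of z s] z s r0 by simp
      also have "\<dots> \<le> cmod (a * z + b * cnj z - - R z)"
        by (rule norm_triangle_ineq2)
      also have "\<dots> = cmod (u z)" using u[of z] z s r0 by simp
      finally show ?thesis using s by simp
    qed
    with s show "\<exists>s. 0 < s \<and> s < r0 \<and> (\<forall>z. cmod z = s \<longrightarrow> \<rho> < cmod (u z))" by blast
  qed
  then show "\<exists>R0. R0 \<ge> 4 * M * r0 ^ 2 / (pi * (1 - r0) ^ 3) *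
                 (- (4 / 5 * r0 ^ 3) + 9 / 4 * r0 ^ 2 - 2 * r0 + 3 / 2) \<and>
              univalent_disk u (ball 0 r0) 0 R0"
    unfolding R0_def by blast
qed

end
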